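(* Let $n_4,k\in\mathbb{N}$. If $k\ge 2$, then $P_2\square P_2\square P_2\square P_{n_4}$ is equitably $k$-list arborable.
   Context: $P_n$ denotes the path on $n$ vertices and $\square$ the Cartesian product. A $k$-uniform list assignment $L$ for $G$ assigns to each vertex $v$ a set $L(v)$ of exactly $k$ colours; an $L$-colouring is a map $c$ with $c(v)\in L(v)$; it is equitable if every colour class has at most $\lceil |V(G)|/k\rceil$ vertices. $G$ is equitably $k$-list arborable if for every $k$-uniform list assignment $L$ there is an equitable $L$-colouring of $G$ in which every colour class induces an acyclic subgraph. *)

theory Defs
  imports Complex_Main "Graph_Theory.Graph_Theory"
begin

text \<open>
  Finite simple graphs are represented, as in the \<open>Graph_Theory\<close> library, by symmetric loop-free
  digraphs without parallel arcs (locale \<open>pair_graph\<close>): an undirected edge is a pair of opposite arcs.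
\<close>

definition path_graph :: "nat \<Rightarrow> nat pair_pre_digraph" where
  "path_graph n =
     \<lparr>pverts = {..<n}, parcs = {(i, j). i < n \<and> j < n \<and> (j = Suc i \<or> i = Suc j)}\<rparr>"

definition cartesian_product ::
    "'a pair_pre_digraph \<Rightarrow> 'b pair_pre_digraph \<Rightarrow> ('a \<times> 'b) pair_pre_digraph"
    (infixl \<open>\<box>\<close> 75) where
  "G \<box> H =
     \<lparr>pverts = pverts G \<times> pverts H,
      parcs = {((u, x), (v, y)).
        (u = v \<and> u \<in> pverts G \<and> (x, y) \<in> parcs H) \<or>
        ((u, v) \<in> parcs G \<and> x = y \<and> x \<in> pverts H)}\<rparr>"

lemma pair_graph_path_graph: "pair_graph (path_graph n)"
proof -
  have "finite {(i, j). i < n \<and> j < n \<and> (j = Suc i \<or> i = Suc j)}"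
    by (rule finite_subset[of _ "{..<n} \<times> {..<n}"]) auto
  then show ?thesis
    by unfold_locales (auto simp: path_graph_def symmetric_def sym_def)
qed

lemma pair_graph_cartesian_product:
  assumes "pair_graph G" and "pair_graph H"
  shows "pair_graph (G \<box> H)"
proof -
  interpret G: pair_graph G by fact
  interpret H: pair_graph H by fact
  have sG: "(v, u) \<in> parcs G" if "(u, v) \<in> parcs G" for u v
    using G.pair_sym_arcs that unfolding symmetric_def with_proj_simps by (rule symD)
  have sH: "(v, u) \<in> parcs H" if "(u, v) \<in> parcs H" for u v
    using H.pair_sym_arcs that unfolding symmetric_def with_proj_simps by (rule symD)
  have V: "finite (pverts (G \<box> H))"
    using G.pair_finite_verts H.pair_finite_verts by (simp add: cartesian_product_def)
  have A: "parcs (G \<box> H) \<subseteq> pverts (G \<box> H) \<times> pverts (G \<box> H)"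
    by (auto simp: cartesian_product_def dest: G.in_arcsD1 G.in_arcsD2 H.in_arcsD1 H.in_arcsD2)
  show ?thesis
  proof unfold_locales
    show "finite (pverts (G \<box> H))" by (rule V)
    show "finite (parcs (G \<box> H))" using finite_subset[OF A] V by simp
    show "symmetric (with_proj (G \<box> H))"
      unfolding symmetric_def with_proj_simps sym_def
      by (auto simp: cartesian_product_def sG sH)
  next
    fix e assume e: "e \<in> parcs (G \<box> H)"
    have "e \<in> pverts (G \<box> H) \<times> pverts (G \<box> H)" using A e by (rule subsetD)
    then show "fst e \<in> pverts (G \<box> H)" "snd e \<in> pverts (G \<box> H)"
      by (simp_all add: mem_Times_iff)
    have "x \<noteq> y" if "(x, y) \<in> parcs G" for x y using G.pair_no_loops[OF that] by simp
    moreover have "x \<noteq> y" if "(x, y) \<in> parcs H" for x y using H.pair_no_loops[OF that] by simp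
    ultimately show "fst e \<noteq> snd e"
      using e by (auto simp: cartesian_product_def)
  qed
qed

text \<open>
  The library's \<open>forest\<close> cannot be used for undirected graphs in this representation: it forbids all
  directed cycles, and both arcs of a single undirected edge already form one, of length 2. The
  cycles of a simple undirected graph are the directed cycles of length at least 3.
\<close>

definition acyclic_graph :: "('a, 'b) pre_digraph \<Rightarrow> bool" where
  "acyclic_graph G \<longleftrightarrow> \<not> (\<exists>p. pre_digraph.cycle G p \<and> 3 \<le> length p)"

definition uniform_list_assignment ::
    "('a, 'b) pre_digraph \<Rightarrow> nat \<Rightarrow> ('a \<Rightarrow> 'c set) \<Rightarrow> bool" where
  "uniform_list_assignment G k L \<longleftrightarrow> (\<forall>v\<in>verts G. finite (L v) \<and> card (L v) = k)"

definition list_colouring ::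
    "('a, 'b) pre_digraph \<Rightarrow> ('a \<Rightarrow> 'c set) \<Rightarrow> ('a \<Rightarrow> 'c) \<Rightarrow> bool" where
  "list_colouring G L c \<longleftrightarrow> (\<forall>v\<in>verts G. c v \<in> L v)"

definition colour_class :: "('a, 'b) pre_digraph \<Rightarrow> ('a \<Rightarrow> 'c) \<Rightarrow> 'c \<Rightarrow> 'a set" where
  "colour_class G c x = {v \<in> verts G. c v = x}"

definition equitable_colouring :: "('a, 'b) pre_digraph \<Rightarrow> nat \<Rightarrow> ('a \<Rightarrow> 'c) \<Rightarrow> bool" where
  "equitable_colouring G k c \<longleftrightarrow>
     (\<forall>x. int (card (colour_class G c x)) \<le> \<lceil>real (card (verts G)) / real k\<rceil>)"

text \<open>
  A definition cannot quantify over types, so the type of colours is passed as an argument;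
  it is left arbitrary in statements.
\<close>

definition equitably_list_arborable ::
    "'c itself \<Rightarrow> nat \<Rightarrow> ('a, 'b) pre_digraph \<Rightarrow> bool" where
  "equitably_list_arborable (_ :: 'c itself) k G \<longleftrightarrow>
     (\<forall>L :: 'a \<Rightarrow> 'c set. uniform_list_assignment G k L \<longrightarrow>
       (\<exists>c. list_colouring G L c \<and> equitable_colouring G k c \<and>
            (\<forall>x. acyclic_graph (G \<restriction> colour_class G c x))))"

end

theory Submission
  imports Defs
begin

text \<open>
  A colour class is acyclic as soon as each of its nonempty subsets contains a vertex with at most
  one neighbour in the subset. Colourings with this property are built by adding \<open>k\<close>
  vertices with pairwise distinct colours at a time, so that a colour class grows by at most one
  vertex per \<open>k\<close> vertices.

  A new vertex may get any colour of its list that does not occur twice among its old neighbours.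
  With \<open>k \<ge> 3\<close> all degrees are at most 5, so at most two colours are forbidden,
  and it suffices that one of the \<open>k\<close> new vertices has at most one old neighbour and
  a second one at most three. Near the top level every set of at least \<open>k\<close> vertices
  contains such a group, except when \<open>k = 3\<close> and the top level is a full cube; then
  six vertices are added in two groups.

  With \<open>k = 2\<close> a whole cube is added on top of the previous level. It consists of two
  4-cycles joined by a perfect matching, whose edges are made bichromatic: this bounds each colour
  class by four vertices per cube and decouples the 4-cycles, so that only finitely many equality
  patterns matter.
\<close>

subsection \<open>Degenerate colourings\<close>

text \<open>For a finite simple graph, 1-degenerate colour classes are the same as forests.
  Quantifying over monochromatic sets rather than cycles suits extensions: only sets containing a
  new vertex have to be examined.\<close>

definition mono_degenerate :: "('v \<Rightarrow> 'v set) \<Rightarrow> 'v set \<Rightarrow> ('v \<Rightarrow> 'c) \<Rightarrow> bool" where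
  "mono_degenerate N V c \<longleftrightarrow>
     (\<forall>W\<subseteq>V. W \<noteq> {} \<longrightarrow> (\<forall>u\<in>W. \<forall>v\<in>W. c u = c v) \<longrightarrow> (\<exists>v\<in>W. card (N v \<inter> W) \<le> 1))"

definition degenerate_colouring ::
    "('v \<Rightarrow> 'v set) \<Rightarrow> ('v \<Rightarrow> 'c set) \<Rightarrow> nat \<Rightarrow> 'v set \<Rightarrow> ('v \<Rightarrow> 'c) \<Rightarrow> bool" where
  "degenerate_colouring N L m V c \<longleftrightarrow>
     (\<forall>v\<in>V. c v \<in> L v) \<and> (\<forall>a. card {v \<in> V. c v = a} \<le> m) \<and> mono_degenerate N V c"

lemma degenerate_colouring_empty: "degenerate_colouring N L m {} c"
  by (auto simp: degenerate_colouring_def mono_degenerate_def)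

lemma mono_degenerateD:
  assumes "mono_degenerate N V c" "W \<subseteq> V" "W \<noteq> {}" "\<And>u v. u \<in> W \<Longrightarrow> v \<in> W \<Longrightarrow> c u = c v"
  shows "\<exists>v\<in>W. card (N v \<inter> W) \<le> 1"
  using assms unfolding mono_degenerate_def by blast

text \<open>Greedy choice from the end of the list: the entries after index \<open>i\<close> use at
  most \<open>length xs - i - 1\<close> colours. Entries with few available colours therefore belong
  at the end.\<close>

lemma distinct_representatives:
  assumes "distinct xs" and "\<And>i. i < length xs \<Longrightarrow> length xs - i \<le> card (A (xs ! i))"
  shows "\<exists>d. inj_on d (set xs) \<and> (\<forall>x\<in>set xs. d x \<in> A x)"
  using assms
proof (induction xs)
  case Nil
  then show ?case by simp
next
  case (Cons x xs)
  have "length xs - i \<le> card (A (xs ! i))" if "i < length xs" for i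
    using Cons.prems(2)[of "Suc i"] that by simp
  with Cons obtain d where d: "inj_on d (set xs)" "\<forall>x\<in>set xs. d x \<in> A x"
    by auto
  have "card (d ` set xs) < card (A x)"
    using Cons.prems(2)[of 0] card_image_le[of "set xs" d] card_length[of xs] by simp
  then have "\<not> A x \<subseteq> d ` set xs"
    using card_mono[of "d ` set xs" "A x"] by auto
  then obtain a where a: "a \<in> A x" "a \<notin> d ` set xs" by blast
  have "x \<notin> set xs" using Cons.prems(1) by simp
  then have "inj_on (d(x := a)) (set (x # xs)) \<and> (\<forall>y\<in>set (x # xs). (d(x := a)) y \<in> A y)"
    using a d by (auto simp: inj_on_def)
  then show ?case by blast
qed

section \<open>Colours forbidden by repetition among old neighbours\<close>

lemma repeated_colours_subset: "{a. 2 \<le> card {u \<in> M. c u = a}} \<subseteq> c ` M"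
proof
  fix a assume "a \<in> {a. 2 \<le> card {u \<in> M. c u = a}}"
  then have "card {u \<in> M. c u = a} \<noteq> 0" by simp
  then obtain u where "u \<in> {u \<in> M. c u = a}" by (metis card.empty ex_in_conv)
  then show "a \<in> c ` M" by auto
qed

lemma card_repeated_colours:
  assumes "finite M"
  shows "2 * card {a. 2 \<le> card {u \<in> M. c u = a}} \<le> card M"
proof -
  let ?F = "{a. 2 \<le> card {u \<in> M. c u = a}}"
  have F: "finite ?F"
    by (rule finite_subset[OF repeated_colours_subset finite_imageI[OF assms]])
  have "2 * card ?F = (\<Sum>a\<in>?F. 2)" by simp
  also have "\<dots> \<le> (\<Sum>a\<in>?F. card {u \<in> M. c u = a})" by (rule sum_mono) simp
  also have "\<dots> = card (\<Union>a\<in>?F. {u \<in> M. c u = a})"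
    using F assms by (subst card_UN_disjoint) auto
  also have "\<dots> \<le> card M" using assms by (intro card_mono) auto
  finally show ?thesis .
qed

text \<open>The colours that a new vertex with old neighbours \<open>M\<close> may receive: at most
  one of these neighbours then joins it in its class.\<close>

definition unrepeated_colours :: "('v \<Rightarrow> 'c) \<Rightarrow> 'v set \<Rightarrow> 'c set" where
  "unrepeated_colours c M = {a. card {u \<in> M. c u = a} \<le> 1}"

text \<open>A forbidden colour uses up two vertices of \<open>M\<close>, so one neighbour forbids no
  colour, three forbid at most one, five at most two.\<close>

lemma card_unrepeated_colours:
  assumes "finite M" "card M \<le> Suc (2 * j)"
  shows "card A - j \<le> card (A \<inter> unrepeated_colours c M)"
proof -
  let ?F = "{a. 2 \<le> card {u \<in> M. c u = a}}"
  have "A = (A \<inter> unrepeated_colours c M) \<union> (A \<inter> ?F)"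
    by (auto simp: unrepeated_colours_def)
  then have "card A \<le> card (A \<inter> unrepeated_colours c M) + card (A \<inter> ?F)"
    by (metis card_Un_le)
  moreover have "finite ?F"
    by (rule finite_subset[OF repeated_colours_subset finite_imageI[OF assms(1)]])
  then have "card (A \<inter> ?F) \<le> card ?F" by (intro card_mono) auto
  moreover have "card ?F \<le> j" using card_repeated_colours[OF assms(1), of c] assms(2) by linarith
  ultimately show ?thesis by linarith
qed

text \<open>A monochromatic set contains at most one new vertex; its neighbours in the set are then
  old, so it is itself the required leaf. The sets \<open>A x\<close> may be smaller than the
  admissible ones, which lets a caller impose further conditions on the new colours.\<close>

lemma extend_by_distinct_colours:
  assumes c: "degenerate_colouring N L m V c" and "finite V" "distinct xs" "set xs \<inter> V = {}"
    and irrefl: "\<And>x. x \<in> set xs \<Longrightarrow> x \<notin> N x"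
    and A: "\<And>x. x \<in> set xs \<Longrightarrow> A x \<subseteq> L x \<inter> unrepeated_colours c (N x \<inter> V)"
    and card: "\<And>i. i < length xs \<Longrightarrow> length xs - i \<le> card (A (xs ! i))"
  shows "\<exists>d. degenerate_colouring N L (Suc m) (V \<union> set xs) d \<and> (\<forall>v\<in>V. d v = c v) \<and>
           (\<forall>x\<in>set xs. d x \<in> A x)"
proof -
  obtain e where e: "inj_on e (set xs)" "\<And>x. x \<in> set xs \<Longrightarrow> e x \<in> A x"
    using distinct_representatives[OF \<open>distinct xs\<close>, of A] card by blast
  define d where "d v = (if v \<in> set xs then e v else c v)" for v
  have dV: "d v = c v" if "v \<in> V" for v using that assms(4) by (auto simp: d_def)
  have dx: "d x = e x" if "x \<in> set xs" for x using that by (simp add: d_def)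
  have inj: "inj_on d (set xs)" using e(1) dx by (simp add: inj_on_def)
  have size: "card {v \<in> V \<union> set xs. d v = a} \<le> Suc m" for a
  proof -
    have "{v \<in> V \<union> set xs. d v = a} \<subseteq> {v \<in> V. c v = a} \<union> {x \<in> set xs. d x = a}"
      using dV by auto
    then have "card {v \<in> V \<union> set xs. d v = a} \<le> card ({v \<in> V. c v = a} \<union> {x \<in> set xs. d x = a})"
      using \<open>finite V\<close> by (intro card_mono) auto
    also have "\<dots> \<le> card {v \<in> V. c v = a} + card {x \<in> set xs. d x = a}" by (rule card_Un_le)
    also have "card {x \<in> set xs. d x = a} \<le> Suc 0"
      using inj by (subst card_le_Suc0_iff_eq) (simp_all add: inj_on_def)
    also have "card {v \<in> V. c v = a} \<le> m" using c by (simp add: degenerate_colouring_def)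
    finally show ?thesis by simp
  qed
  have leaf: "\<exists>v\<in>W. card (N v \<inter> W) \<le> 1"
    if W: "W \<subseteq> V \<union> set xs" "W \<noteq> {}" "\<forall>u\<in>W. \<forall>v\<in>W. d u = d v" for W
  proof (cases "W \<inter> set xs = {}")
    case True
    then have "W \<subseteq> V" using W(1) by blast
    have "c u = c v" if "u \<in> W" "v \<in> W" for u v
    proof -
      have "d u = d v" using W(3) that by blast
      moreover have "u \<in> V" "v \<in> V" using that \<open>W \<subseteq> V\<close> by blast+
      ultimately show ?thesis using dV by simp
    qed
    moreover have "mono_degenerate N V c" using c by (simp add: degenerate_colouring_def)
    ultimately show ?thesis using mono_degenerateD \<open>W \<subseteq> V\<close> W(2) by metis
  next
    case False
    then obtain x where x: "x \<in> W" "x \<in> set xs" by blast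
    have "y = x" if "y \<in> W" "y \<in> set xs" for y
    proof -
      have "d y = d x" using W(3) that x by blast
      then show ?thesis using inj that x by (simp only: inj_on_eq_iff)
    qed
    then have "W - V \<subseteq> {x}" using W(1) by blast
    have "N x \<inter> W \<subseteq> {u \<in> N x \<inter> V. c u = d x}"
    proof
      fix u assume u: "u \<in> N x \<inter> W"
      then have "u \<noteq> x" using irrefl[OF x(2)] by blast
      then have "u \<in> V" using u \<open>W - V \<subseteq> {x}\<close> by blast
      moreover have "d u = d x" using W(3) u x by blast
      ultimately show "u \<in> {u \<in> N x \<inter> V. c u = d x}" using u dV by simp
    qed
    then have "card (N x \<inter> W) \<le> card {u \<in> N x \<inter> V. c u = d x}"
      using \<open>finite V\<close> by (intro card_mono) auto
    moreover have "d x \<in> unrepeated_colours c (N x \<inter> V)"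
      using A[OF x(2)] e(2)[OF x(2)] dx[OF x(2)] by auto
    then have "card {u \<in> N x \<inter> V. c u = d x} \<le> 1"
      by (simp only: unrepeated_colours_def mem_Collect_eq)
    ultimately have "card (N x \<inter> W) \<le> 1" by (rule order_trans)
    then show ?thesis using x(1) by (rule bexI)
  qed
  have "mono_degenerate N (V \<union> set xs) d"
    unfolding mono_degenerate_def by (intro allI impI) (rule leaf)
  moreover have "\<forall>v\<in>V \<union> set xs. d v \<in> L v"
  proof
    fix v assume "v \<in> V \<union> set xs"
    then consider "v \<in> V" | "v \<in> set xs" by blast
    then show "d v \<in> L v"
    proof cases
      case 1
      then show ?thesis using dV c by (simp add: degenerate_colouring_def)
    next
      case 2
      then have "d v \<in> A v" using dx e(2) by simp
      then show ?thesis using A[OF 2] by blast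
    qed
  qed
  ultimately have D: "degenerate_colouring N L (Suc m) (V \<union> set xs) d"
    using size by (simp add: degenerate_colouring_def)
  have E: "d x \<in> A x" if "x \<in> set xs" for x using dx e(2) that by simp
  show ?thesis by (intro exI[of _ d] conjI ballI D dV E)
qed

subsection \<open>Colouring two opposite faces of a cube from lists of size two\<close>

text \<open>The colours of a 4-cycle and those of the vertices below it, such that no colour class
  contains the cycle or a path of length at least 1 whose ends both have the colour of the vertex
  below. Since equally coloured vertices below may be connected in their class, such a path could
  close a cycle.\<close>

definition good_face :: "'c \<Rightarrow> 'c \<Rightarrow> 'c \<Rightarrow> 'c \<Rightarrow> 'c \<Rightarrow> 'c \<Rightarrow> 'c \<Rightarrow> 'c \<Rightarrow> bool" where
  "good_face x0 x1 x2 x3 p0 p1 p2 p3 \<longleftrightarrow>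
     \<not> (x0 = x1 \<and> x1 = x2 \<and> x2 = x3) \<and>
     \<not> (x0 = x1 \<and> x0 = p0 \<and> x1 = p1) \<and> \<not> (x1 = x2 \<and> x1 = p1 \<and> x2 = p2) \<and>
     \<not> (x2 = x3 \<and> x2 = p2 \<and> x3 = p3) \<and> \<not> (x3 = x0 \<and> x3 = p3 \<and> x0 = p0) \<and>
     \<not> (x0 = x1 \<and> x1 = x2 \<and> x0 = p0 \<and> x2 = p2) \<and> \<not> (x1 = x2 \<and> x2 = x3 \<and> x1 = p1 \<and> x3 = p3) \<and>
     \<not> (x2 = x3 \<and> x3 = x0 \<and> x2 = p2 \<and> x0 = p0) \<and> \<not> (x3 = x0 \<and> x0 = x1 \<and> x3 = p3 \<and> x1 = p1)"

text \<open>The \<open>w\<close> say which cycle vertices lie in the set, the \<open>e\<close> which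
  vertices below do. Without a leaf, the set would contain the whole cycle, or a path with at least
  one edge whose ends both continue downwards; these are the nine configurations excluded by
  \<open>good_face\<close>.\<close>

lemma good_face_leaf:
  assumes "good_face x0 x1 x2 x3 p0 p1 p2 p3"
    and "w0 \<or> w1 \<or> w2 \<or> w3"
    and "w0 \<and> w1 \<longrightarrow> x0 = x1" "w1 \<and> w2 \<longrightarrow> x1 = x2" "w2 \<and> w3 \<longrightarrow> x2 = x3" "w3 \<and> w0 \<longrightarrow> x3 = x0"
      "w0 \<and> w2 \<longrightarrow> x0 = x2" "w1 \<and> w3 \<longrightarrow> x1 = x3"
    and "w0 \<and> e0 \<longrightarrow> x0 = p0" "w1 \<and> e1 \<longrightarrow> x1 = p1" "w2 \<and> e2 \<longrightarrow> x2 = p2" "w3 \<and> e3 \<longrightarrow> x3 = p3"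
  shows "w0 \<and> (\<not> w3 \<and> \<not> w1 \<or> \<not> w3 \<and> \<not> e0 \<or> \<not> w1 \<and> \<not> e0) \<or>
         w1 \<and> (\<not> w0 \<and> \<not> w2 \<or> \<not> w0 \<and> \<not> e1 \<or> \<not> w2 \<and> \<not> e1) \<or>
         w2 \<and> (\<not> w1 \<and> \<not> w3 \<or> \<not> w1 \<and> \<not> e2 \<or> \<not> w3 \<and> \<not> e2) \<or>
         w3 \<and> (\<not> w2 \<and> \<not> w0 \<or> \<not> w2 \<and> \<not> e3 \<or> \<not> w0 \<and> \<not> e3)"
  using assms unfolding good_face_def by argo

text \<open>A choice of colours from lists of size 2 is a vector of truth values;
  \<open>True\<close> stands for the colour of the vertex below if that colour is in the list. The
  following three collections of good choices are those of the extreme cases with four equal lists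
  \<open>{a, b}\<close>: the colours below are constant, alternating, or constant except below the
  first vertex.\<close>

type_synonym face_pred = "bool \<Rightarrow> bool \<Rightarrow> bool \<Rightarrow> bool \<Rightarrow> bool"

definition options_uniform :: "face_pred \<Rightarrow> bool" where
  "options_uniform g \<longleftrightarrow>
     g True False False False \<and> g False True False False \<and> g False False True False \<and> g False False False True \<and>
     g True False True False \<and> g False True False True"

definition options_alternating :: "face_pred \<Rightarrow> bool" where
  "options_alternating g \<longleftrightarrow> g False False False False \<and>
     g True False False False \<and> g False True False False \<and> g False False True False \<and> g False False False True \<and>
     g True True False False \<and> g False True True False \<and> g False False True True \<and> g True False False True \<and>
     g True True True True"

definition options_corner :: "face_pred \<Rightarrow> bool" where
  "options_corner g \<longleftrightarrow> g False False False False \<and>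
     g False True False False \<and> g False False True False \<and> g False False False True \<and>
     g True True False False \<and> g True False True False \<and> g True False False True \<and> g True True False True"

definition rotate_face :: "face_pred \<Rightarrow> face_pred" where
  "rotate_face g s0 s1 s2 s3 = g s3 s0 s1 s2"

text \<open>Each rotation moves the exceptional vertex of \<open>options_corner\<close> one position
  along the cycle.\<close>

definition options_any_corner :: "face_pred \<Rightarrow> bool" where
  "options_any_corner g \<longleftrightarrow> options_corner g \<or> options_corner (rotate_face g) \<or>
     options_corner (rotate_face (rotate_face g)) \<or> options_corner (rotate_face (rotate_face (rotate_face g)))"

text \<open>\<open>good_face\<close> is a conjunction of negated coincidences, so additional
  equations between colours can only remove choices; the case splits locate the equations that
  matter.\<close>

lemma face_options_cases:
  fixes B0 B1 B2 B3 O0 O1 O2 O3 p0 p1 p2 p3 :: 'c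
  assumes ne: "B0 \<noteq> O0" "B1 \<noteq> O1" "B2 \<noteq> O2" "B3 \<noteq> O3" "O0 \<noteq> p0" "O1 \<noteq> p1" "O2 \<noteq> p2" "O3 \<noteq> p3"
  defines "g \<equiv> \<lambda>s0 s1 s2 s3. good_face (if s0 then B0 else O0) (if s1 then B1 else O1)
                (if s2 then B2 else O2) (if s3 then B3 else O3) p0 p1 p2 p3"
  shows "options_uniform g \<or> options_alternating g \<or> options_any_corner g"
proof -
  note corner = options_corner_def rotate_face_def g_def good_face_def
  note alternating = options_alternating_def g_def good_face_def
  note uniform = options_uniform_def g_def good_face_def
  \<comment> \<open>Since each \<open>O\<close> colour differs from the colour below, a single
    \<open>True\<close> fails only by making the whole cycle monochromatic. Each of the first four
    cases is such a failure and gives the corner pattern at that vertex.\<close>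
  consider
      "B0 = O1" "O1 = O2" "O2 = O3" | "B1 = O0" "O0 = O2" "O2 = O3"
    | "B2 = O0" "O0 = O1" "O1 = O3" | "B3 = O0" "O0 = O1" "O1 = O2"
    | "\<not> (B0 = O1 \<and> O1 = O2 \<and> O2 = O3)" "\<not> (B1 = O0 \<and> O0 = O2 \<and> O2 = O3)"
      "\<not> (B2 = O0 \<and> O0 = O1 \<and> O1 = O3)" "\<not> (B3 = O0 \<and> O0 = O1 \<and> O1 = O2)"
    by blast
  then show ?thesis
  proof cases
    case 1
    then have "options_corner g" using ne unfolding corner by auto
    then show ?thesis by (simp add: options_any_corner_def)
  next
    case 2
    then have "options_corner (rotate_face g)" using ne unfolding corner by auto
    then show ?thesis by (simp add: options_any_corner_def)
  next
    case 3
    then have "options_corner (rotate_face (rotate_face g))" using ne unfolding corner by auto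
    then show ?thesis by (simp add: options_any_corner_def)
  next
    case 4
    then have "options_corner (rotate_face (rotate_face (rotate_face g)))"
      using ne unfolding corner by auto
    then show ?thesis by (simp add: options_any_corner_def)
  next
    case 5
    \<comment> \<open>All single choices are good now, and the two diagonal choices of
      \<open>options_uniform\<close> can fail only through a path whose middle vertex takes
      \<open>False\<close>. After such a failure the \<open>B\<close> colour of the fourth vertex
      decides between a corner and the alternating pattern.\<close>
    consider "B0 = B2" "B0 = O1" "B3 = B0" | "B0 = B2" "B0 = O1" "B3 \<noteq> B0"
      | "B0 = B2" "B0 = O3" "B1 = B0" | "B0 = B2" "B0 = O3" "B1 \<noteq> B0"
      | "B1 = B3" "B1 = O2" "B0 = B1" | "B1 = B3" "B1 = O2" "B0 \<noteq> B1"
      | "B1 = B3" "B1 = O0" "B2 = B1" | "B1 = B3" "B1 = O0" "B2 \<noteq> B1"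
      | "\<not> (B0 = B2 \<and> (B0 = O1 \<or> B0 = O3))" "\<not> (B1 = B3 \<and> (B1 = O2 \<or> B1 = O0))"
      by blast
    then show ?thesis
    proof cases
      case 1
      then have "options_corner (rotate_face g)" using ne unfolding corner by auto
      then show ?thesis by (simp add: options_any_corner_def)
    next
      case 2
      then have "options_alternating g" using ne 5 unfolding alternating by auto
      then show ?thesis by blast
    next
      case 3
      then have "options_corner (rotate_face (rotate_face (rotate_face g)))" using ne
        unfolding corner by auto
      then show ?thesis by (simp add: options_any_corner_def)
    next
      case 4
      then have "options_alternating g" using ne 5 unfolding alternating by auto
      then show ?thesis by blast
    next
      case _: 5
      then have "options_corner (rotate_face (rotate_face g))" using ne unfolding corner by auto
      then show ?thesis by (simp add: options_any_corner_def)
    next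
      case 6
      then have "options_alternating g" using ne 5 unfolding alternating by auto
      then show ?thesis by blast
    next
      case 7
      then have "options_corner g" using ne unfolding corner by auto
      then show ?thesis by (simp add: options_any_corner_def)
    next
      case 8
      then have "options_alternating g" using ne 5 unfolding alternating by auto
      then show ?thesis by blast
    next
      case 9
      then have "options_uniform g" using ne 5 unfolding uniform by auto
      then show ?thesis by blast
    qed
  qed
qed

text \<open>A component of \<open>t\<close> tells whether the second cycle copies or negates the
  truth value of the first. This is a finite Boolean check; in the exception the complements of the
  uniform options are triples and diagonal pairs, which \<open>options_alternating\<close> does not
  provide.\<close>

lemma face_options_match:
  assumes "options_uniform g \<or> options_alternating g \<or> options_any_corner g"
    and "options_uniform h \<or> options_alternating h \<or> options_any_corner h"
  shows "(\<exists>s0 s1 s2 s3. g s0 s1 s2 s3 \<and> h (s0 \<noteq> t0) (s1 \<noteq> t1) (s2 \<noteq> t2) (s3 \<noteq> t3)) \<or>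
    t0 \<and> t1 \<and> t2 \<and> t3 \<and>
      (options_uniform g \<and> options_alternating h \<or> options_alternating g \<and> options_uniform h)"
  using assms
  unfolding ex_bool_eq options_uniform_def options_alternating_def options_any_corner_def options_corner_def
    rotate_face_def
  by (cases t0; cases t1; cases t2; cases t3; (simp only: simp_thms not_True_eq_False not_False_eq_True)?; argo)

text \<open>The case left open by \<open>face_options_match\<close>. If at some position both
  cycles may choose the same truth value, this freedom suffices; otherwise the
  \<open>False\<close> colours of both cycles coincide, hence are not all equal, and choosing them
  throughout the first cycle is good.\<close>

lemma face_options_exception:
  fixes B0 B1 B2 B3 O0 O1 O2 O3 b0 b1 b2 b3 o0 o1 o2 o3 p0 p1 p2 p3 q0 q1 q2 q3 :: 'c
  defines "g \<equiv> \<lambda>s0 s1 s2 s3. good_face (if s0 then B0 else O0) (if s1 then B1 else O1)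
                (if s2 then B2 else O2) (if s3 then B3 else O3) p0 p1 p2 p3"
    and "h \<equiv> \<lambda>s0 s1 s2 s3. good_face (if s0 then b0 else o0) (if s1 then b1 else o1)
                (if s2 then b2 else o2) (if s3 then b3 else o3) q0 q1 q2 q3"
    and "v0 \<equiv> \<lambda>s t. (if s then B0 else O0) \<noteq> (if t then b0 else o0)"
    and "v1 \<equiv> \<lambda>s t. (if s then B1 else O1) \<noteq> (if t then b1 else o1)"
    and "v2 \<equiv> \<lambda>s t. (if s then B2 else O2) \<noteq> (if t then b2 else o2)"
    and "v3 \<equiv> \<lambda>s t. (if s then B3 else O3) \<noteq> (if t then b3 else o3)"
  assumes ne: "O0 \<noteq> p0" "O1 \<noteq> p1" "O2 \<noteq> p2" "O3 \<noteq> p3"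
    and v: "\<And>s. v0 s (\<not> s)" "\<And>s. v1 s (\<not> s)" "\<And>s. v2 s (\<not> s)" "\<And>s. v3 s (\<not> s)"
    and g: "options_uniform g" and h: "options_alternating h"
  shows "\<exists>s0 s1 s2 s3 t0 t1 t2 t3. g s0 s1 s2 s3 \<and> h t0 t1 t2 t3 \<and> v0 s0 t0 \<and> v1 s1 t1 \<and> v2 s2 t2 \<and>
      v3 s3 t3"
proof -
  note G = g[unfolded options_uniform_def] and H = h[unfolded options_alternating_def]
  have v': "v0 True False" "v0 False True" "v1 True False" "v1 False True"
    "v2 True False" "v2 False True" "v3 True False" "v3 False True"
    using v[of True] v[of False] by simp_all
  \<comment> \<open>At the free position both cycles take the same truth value, elsewhere opposite
    ones. A single \<open>True\<close> in the first cycle then leaves all \<open>True\<close> or two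
    adjacent \<open>True\<close> values in the second, both alternating options.\<close>
  consider "v0 True True" | "v0 False False" | "v1 True True" | "v1 False False"
    | "v2 True True" | "v2 False False" | "v3 True True" | "v3 False False"
    | "\<not> v0 True True" "\<not> v0 False False" "\<not> v1 True True" "\<not> v1 False False"
      "\<not> v2 True True" "\<not> v2 False False" "\<not> v3 True True" "\<not> v3 False False"
    by blast
  then show ?thesis
  proof cases
    case 1
    then have "g True False False False \<and> h True True True True \<and>
        v0 True True \<and> v1 False True \<and> v2 False True \<and> v3 False True"
      using v' G H by simp
    then show ?thesis by blast
  next
    case 2
    then have "g False True False False \<and> h False False True True \<and>
        v0 False False \<and> v1 True False \<and> v2 False True \<and> v3 False True"
      using v' G H by simp
    then show ?thesis by blast
  next
    case 3
    then have "g False True False False \<and> h True True True True \<and>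
        v0 False True \<and> v1 True True \<and> v2 False True \<and> v3 False True"
      using v' G H by simp
    then show ?thesis by blast
  next
    case 4
    then have "g False False True False \<and> h True False False True \<and>
        v0 False True \<and> v1 False False \<and> v2 True False \<and> v3 False True"
      using v' G H by simp
    then show ?thesis by blast
  next
    case 5
    then have "g False False True False \<and> h True True True True \<and>
        v0 False True \<and> v1 False True \<and> v2 True True \<and> v3 False True"
      using v' G H by simp
    then show ?thesis by blast
  next
    case 6
    then have "g False False False True \<and> h True True False False \<and>
        v0 False True \<and> v1 False True \<and> v2 False False \<and> v3 True False"
      using v' G H by simp
    then show ?thesis by blast
  next
    case 7
    then have "g False False False True \<and> h True True True True \<and>
        v0 False True \<and> v1 False True \<and> v2 False True \<and> v3 True True"
      using v' G H by simp
    then show ?thesis by blast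
  next
    case 8
    then have "g True False False False \<and> h False True True False \<and>
        v0 True False \<and> v1 False True \<and> v2 False True \<and> v3 False False"
      using v' G H by simp
    then show ?thesis by blast
  next
    case 9
    then have "O0 = o0" "O1 = o1" "O2 = o2" "O3 = o3"
      by (simp_all add: v0_def v1_def v2_def v3_def)
    moreover have "h False False False False" using H by blast
    ultimately have "g False False False False"
      using ne by (auto simp: g_def h_def good_face_def)
    then have "g False False False False \<and> h True True True True \<and> v0 False True \<and> v1 False True \<and>
        v2 False True \<and> v3 False True" using v' H by simp
    then show ?thesis by blast
  qed
qed

section \<open>Combining the choices on the two faces\<close>

lemma list_pair:
  assumes "card A = 2"
  obtains b d where "A = {b, d}" "b \<noteq> d" "d \<noteq> p"
proof -
  obtain u v where "A = {u, v}" "u \<noteq> v" using assms by (auto simp: card_2_iff)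
  then show thesis using that[of u v] that[of v u] by (cases "v = p") auto
qed

text \<open>Negating the truth value gives different colours unless it pairs a shared colour with
  itself, and then copying the value works.\<close>

lemma distinct_choices:
  assumes "B \<noteq> D" "b \<noteq> d"
  obtains t where "\<And>s. (if s then B else D) \<noteq> (if s \<noteq> t then b else d)"
proof (cases "B \<noteq> d \<and> D \<noteq> b")
  case True
  then show thesis using that[of True] by simp
next
  case False
  then show thesis using assms that[of False] by auto
qed

text \<open>Equal indices belong to matched vertices of the two faces. The bijections from
  \<open>distinct_choices\<close> turn a choice on one face into a choice on the other that differs
  everywhere, which leaves a matching of Boolean options and its exceptional case.\<close>

lemma good_faces_exist:
  fixes U0 U1 U2 U3 V0 V1 V2 V3 :: "'c set" and p0 p1 p2 p3 q0 q1 q2 q3 :: 'c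
  assumes U: "card U0 = 2" "card U1 = 2" "card U2 = 2" "card U3 = 2"
    and V: "card V0 = 2" "card V1 = 2" "card V2 = 2" "card V3 = 2"
  shows "\<exists>x0\<in>U0. \<exists>x1\<in>U1. \<exists>x2\<in>U2. \<exists>x3\<in>U3. \<exists>y0\<in>V0. \<exists>y1\<in>V1. \<exists>y2\<in>V2. \<exists>y3\<in>V3.
    x0 \<noteq> y0 \<and> x1 \<noteq> y1 \<and> x2 \<noteq> y2 \<and> x3 \<noteq> y3 \<and>
    good_face x0 x1 x2 x3 p0 p1 p2 p3 \<and> good_face y0 y1 y2 y3 q0 q1 q2 q3"
proof -
  obtain B0 O0 where A0: "U0 = {B0, O0}" "B0 \<noteq> O0" "O0 \<noteq> p0" using list_pair[OF U(1)] by metis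
  obtain B1 O1 where A1: "U1 = {B1, O1}" "B1 \<noteq> O1" "O1 \<noteq> p1" using list_pair[OF U(2)] by metis
  obtain B2 O2 where A2: "U2 = {B2, O2}" "B2 \<noteq> O2" "O2 \<noteq> p2" using list_pair[OF U(3)] by metis
  obtain B3 O3 where A3: "U3 = {B3, O3}" "B3 \<noteq> O3" "O3 \<noteq> p3" using list_pair[OF U(4)] by metis
  obtain b0 o0 where C0: "V0 = {b0, o0}" "b0 \<noteq> o0" "o0 \<noteq> q0" using list_pair[OF V(1)] by metis
  obtain b1 o1 where C1: "V1 = {b1, o1}" "b1 \<noteq> o1" "o1 \<noteq> q1" using list_pair[OF V(2)] by metis
  obtain b2 o2 where C2: "V2 = {b2, o2}" "b2 \<noteq> o2" "o2 \<noteq> q2" using list_pair[OF V(3)] by metis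
  obtain b3 o3 where C3: "V3 = {b3, o3}" "b3 \<noteq> o3" "o3 \<noteq> q3" using list_pair[OF V(4)] by metis
  define g where "g = (\<lambda>s0 s1 s2 s3. good_face (if s0 then B0 else O0) (if s1 then B1 else O1)
                (if s2 then B2 else O2) (if s3 then B3 else O3) p0 p1 p2 p3)"
  define h where "h = (\<lambda>s0 s1 s2 s3. good_face (if s0 then b0 else o0) (if s1 then b1 else o1)
                (if s2 then b2 else o2) (if s3 then b3 else o3) q0 q1 q2 q3)"
  obtain t0 where t0: "\<And>s. (if s then B0 else O0) \<noteq> (if s \<noteq> t0 then b0 else o0)"
    using distinct_choices[OF A0(2) C0(2)] by metis
  obtain t1 where t1: "\<And>s. (if s then B1 else O1) \<noteq> (if s \<noteq> t1 then b1 else o1)"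
    using distinct_choices[OF A1(2) C1(2)] by metis
  obtain t2 where t2: "\<And>s. (if s then B2 else O2) \<noteq> (if s \<noteq> t2 then b2 else o2)"
    using distinct_choices[OF A2(2) C2(2)] by metis
  obtain t3 where t3: "\<And>s. (if s then B3 else O3) \<noteq> (if s \<noteq> t3 then b3 else o3)"
    using distinct_choices[OF A3(2) C3(2)] by metis
  have go: "options_uniform g \<or> options_alternating g \<or> options_any_corner g"
    unfolding g_def by (rule face_options_cases) (use A0 A1 A2 A3 in simp_all)
  have ho: "options_uniform h \<or> options_alternating h \<or> options_any_corner h"
    unfolding h_def by (rule face_options_cases) (use C0 C1 C2 C3 in simp_all)
  consider s0 s1 s2 s3 where "g s0 s1 s2 s3" "h (s0 \<noteq> t0) (s1 \<noteq> t1) (s2 \<noteq> t2) (s3 \<noteq> t3)"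
    | "t0 \<and> t1 \<and> t2 \<and> t3" "options_uniform g" "options_alternating h"
    | "t0 \<and> t1 \<and> t2 \<and> t3" "options_alternating g" "options_uniform h"
    using face_options_match[OF go ho, of t0 t1 t2 t3] by blast
  then have "\<exists>s0 s1 s2 s3 r0 r1 r2 r3. g s0 s1 s2 s3 \<and> h r0 r1 r2 r3 \<and>
      (if s0 then B0 else O0) \<noteq> (if r0 then b0 else o0) \<and> (if s1 then B1 else O1) \<noteq> (if r1 then b1 else o1) \<and>
      (if s2 then B2 else O2) \<noteq> (if r2 then b2 else o2) \<and> (if s3 then B3 else O3) \<noteq> (if r3 then b3 else o3)"
  proof cases
    case (1 s0 s1 s2 s3)
    then show ?thesis using t0[of s0] t1[of s1] t2[of s2] t3[of s3] by blast
  next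
    case 2
    then have t: "t0 = True" "t1 = True" "t2 = True" "t3 = True" by simp_all
    show ?thesis
      using 2(2,3) t0 t1 t2 t3 A0(3) A1(3) A2(3) A3(3) unfolding g_def h_def t
      by (intro face_options_exception) simp_all
  next
    case 3
    then have t: "t0 = True" "t1 = True" "t2 = True" "t3 = True" by simp_all
    \<comment> \<open>\<open>face_options_exception\<close> expects the uniform face first, so the
      faces exchange roles.\<close>
    have "\<exists>r0 r1 r2 r3 s0 s1 s2 s3. h r0 r1 r2 r3 \<and> g s0 s1 s2 s3 \<and>
      (if r0 then b0 else o0) \<noteq> (if s0 then B0 else O0) \<and> (if r1 then b1 else o1) \<noteq> (if s1 then B1 else O1) \<and>
      (if r2 then b2 else o2) \<noteq> (if s2 then B2 else O2) \<and> (if r3 then b3 else o3) \<noteq> (if s3 then B3 else O3)"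
      using 3(2,3) t0[of "\<not> _"] t1[of "\<not> _"] t2[of "\<not> _"] t3[of "\<not> _"] C0(3) C1(3) C2(3) C3(3)
      unfolding g_def h_def t by (intro face_options_exception) (simp_all add: eq_commute)
    then show ?thesis
      by (elim exE conjE) (intro exI conjI; (assumption | rule not_sym, assumption))
  qed
  then obtain s0 s1 s2 s3 r0 r1 r2 r3 where *: "g s0 s1 s2 s3" "h r0 r1 r2 r3"
      "(if s0 then B0 else O0) \<noteq> (if r0 then b0 else o0)"
        "(if s1 then B1 else O1) \<noteq> (if r1 then b1 else o1)"
      "(if s2 then B2 else O2) \<noteq> (if r2 then b2 else o2)"
        "(if s3 then B3 else O3) \<noteq> (if r3 then b3 else o3)"
    by blast
  show ?thesis
    by (rule bexI[of _ "if s0 then B0 else O0"], rule bexI[of _ "if s1 then B1 else O1"],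
        rule bexI[of _ "if s2 then B2 else O2"], rule bexI[of _ "if s3 then B3 else O3"],
        rule bexI[of _ "if r0 then b0 else o0"], rule bexI[of _ "if r1 then b1 else o1"],
        rule bexI[of _ "if r2 then b2 else o2"], rule bexI[of _ "if r3 then b3 else o3"])
      (use * A0(1) A1(1) A2(1) A3(1) C0(1) C1(1) C2(1) C3(1) in \<open>simp_all add: g_def h_def\<close>)
qed

subsection \<open>Two colours per list\<close>

type_synonym cube_vertex = "(nat \<times> nat) \<times> nat"

definition cube :: "cube_vertex set" where
  "cube = ({..<2} \<times> {..<2}) \<times> {..<2}"

fun cube_nbrs :: "cube_vertex \<Rightarrow> cube_vertex set" where
  "cube_nbrs ((x, y), z) = {((1 - x, y), z), ((x, 1 - y), z), ((x, y), 1 - z)}"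

text \<open>Levels are unbounded above; degrees are counted after intersection with a vertex set.
  Writing \<open>l = Suc m\<close> avoids a spurious neighbour at level 0, where
  \<open>l - 1\<close> is 0.\<close>

definition grid_nbrs :: "cube_vertex \<times> nat \<Rightarrow> (cube_vertex \<times> nat) set" where
  "grid_nbrs v = (case v of (q, l) \<Rightarrow> cube_nbrs q \<times> {l} \<union> {q} \<times> {m. m = Suc l \<or> l = Suc m})"

lemma cube_eq:
  "cube = {((0, 0), 0), ((1, 0), 0), ((1, 1), 0), ((0, 1), 0),
           ((0, 0), 1), ((1, 0), 1), ((1, 1), 1), ((0, 1), 1)}"
proof -
  have "{..<2::nat} = {0, 1}" by auto
  then show ?thesis unfolding cube_def by (simp only:) blast
qed

lemma card_le_1_of_subset_3:
  assumes "X \<subseteq> {a, b, e}" "a \<notin> X \<and> b \<notin> X \<or> a \<notin> X \<and> e \<notin> X \<or> b \<notin> X \<and> e \<notin> X"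
  shows "card X \<le> 1"
proof -
  have "X \<subseteq> {a} \<or> X \<subseteq> {b} \<or> X \<subseteq> {e}" using assms by blast
  then obtain z where "X \<subseteq> {z}" by blast
  then have "card X \<le> card {z}" by (rule card_mono[rotated]) simp
  then show ?thesis by simp
qed

text \<open>The \<open>r\<close> are the partners of the \<open>q\<close> on the opposite face.
  Partners never lie in \<open>W\<close> together and nothing of \<open>W\<close> lies above, so a
  face vertex has in \<open>W\<close> at most its two cycle neighbours and the vertex below, as in
  \<open>good_face_leaf\<close>.\<close>

lemma face_leaf:
  fixes q0 q1 q2 q3 r0 r1 r2 r3 :: cube_vertex and n :: nat and W :: "(cube_vertex \<times> nat) set"
  assumes nbrs: "cube_nbrs q0 = {q3, q1, r0}" "cube_nbrs q1 = {q0, q2, r1}"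
      "cube_nbrs q2 = {q1, q3, r2}" "cube_nbrs q3 = {q2, q0, r3}"
    and cross: "(q0, n) \<in> W \<Longrightarrow> (r0, n) \<notin> W" "(q1, n) \<in> W \<Longrightarrow> (r1, n) \<notin> W"
      "(q2, n) \<in> W \<Longrightarrow> (r2, n) \<notin> W" "(q3, n) \<in> W \<Longrightarrow> (r3, n) \<notin> W"
    and upper: "\<And>q. (q, Suc n) \<notin> W"
    and mono: "\<And>u v. u \<in> W \<Longrightarrow> v \<in> W \<Longrightarrow> d u = d v"
    and good: "good_face (d (q0, n)) (d (q1, n)) (d (q2, n)) (d (q3, n)) p0 p1 p2 p3"
    and below: "0 < n \<Longrightarrow> d (q0, n - 1) = p0" "0 < n \<Longrightarrow> d (q1, n - 1) = p1"
      "0 < n \<Longrightarrow> d (q2, n - 1) = p2" "0 < n \<Longrightarrow> d (q3, n - 1) = p3"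
    and ne: "(q0, n) \<in> W \<or> (q1, n) \<in> W \<or> (q2, n) \<in> W \<or> (q3, n) \<in> W"
  shows "\<exists>v\<in>W. card (grid_nbrs v \<inter> W) \<le> 1"
proof -
  define e where "e q \<longleftrightarrow> 0 < n \<and> (q, n - 1) \<in> W" for q
  have leaf: "\<exists>v\<in>W. card (grid_nbrs v \<inter> W) \<le> 1"
    if "(q, n) \<in> W" "cube_nbrs q = {a, b, r}" "(r, n) \<notin> W"
      "(a, n) \<notin> W \<and> (b, n) \<notin> W \<or> (a, n) \<notin> W \<and> \<not> e q \<or> (b, n) \<notin> W \<and> \<not> e q" for q a b r
  proof (rule bexI[OF _ that(1)], rule card_le_1_of_subset_3)
    \<comment> \<open>At \<open>n = 0\<close> no vertex lies below and \<open>n - 1\<close> would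
      give the vertex itself; level \<open>Suc n\<close> serves as a placeholder outside
      \<open>W\<close>.\<close>
    let ?b = "(q, if n = 0 then Suc n else n - 1)"
    show "grid_nbrs (q, n) \<inter> W \<subseteq> {(a, n), (b, n), ?b}"
      using upper that(3) by (auto simp: grid_nbrs_def that(2))
    have "e q" if "?b \<in> W" using that upper[of q] by (auto simp: e_def split: if_splits)
    then show "(a, n) \<notin> grid_nbrs (q, n) \<inter> W \<and> (b, n) \<notin> grid_nbrs (q, n) \<inter> W \<or>
        (a, n) \<notin> grid_nbrs (q, n) \<inter> W \<and> ?b \<notin> grid_nbrs (q, n) \<inter> W \<or>
        (b, n) \<notin> grid_nbrs (q, n) \<inter> W \<and> ?b \<notin> grid_nbrs (q, n) \<inter> W"
      using that(4) by blast
  qed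
  have "(q0, n) \<in> W \<and> ((q3, n) \<notin> W \<and> (q1, n) \<notin> W \<or> (q3, n) \<notin> W \<and> \<not> e q0 \<or> (q1, n) \<notin> W \<and> \<not> e q0) \<or>
        (q1, n) \<in> W \<and> ((q0, n) \<notin> W \<and> (q2, n) \<notin> W \<or> (q0, n) \<notin> W \<and> \<not> e q1 \<or> (q2, n) \<notin> W \<and> \<not> e q1) \<or>
        (q2, n) \<in> W \<and> ((q1, n) \<notin> W \<and> (q3, n) \<notin> W \<or> (q1, n) \<notin> W \<and> \<not> e q2 \<or> (q3, n) \<notin> W \<and> \<not> e q2) \<or>
        (q3, n) \<in> W \<and> ((q2, n) \<notin> W \<and> (q0, n) \<notin> W \<or> (q2, n) \<notin> W \<and> \<not> e q3 \<or> (q0, n) \<notin> W \<and> \<not> e q3)"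

  proof (rule good_face_leaf[OF good])
    show "(q0, n) \<in> W \<and> e q0 \<longrightarrow> d (q0, n) = p0" "(q1, n) \<in> W \<and> e q1 \<longrightarrow> d (q1, n) = p1"
      "(q2, n) \<in> W \<and> e q2 \<longrightarrow> d (q2, n) = p2" "(q3, n) \<in> W \<and> e q3 \<longrightarrow> d (q3, n) = p3"
      using mono below unfolding e_def by metis+
  qed (use ne mono in blast)+
  then show ?thesis
    using leaf[OF _ nbrs(1) cross(1)] leaf[OF _ nbrs(2) cross(2)] leaf[OF _ nbrs(3) cross(3)]
      leaf[OF _ nbrs(4) cross(4)] by argo
qed

text \<open>The faces differ along the four edges joining them, so each colour occurs at most four
  times in the new layer. A monochromatic set has a leaf on a face of this layer that it meets, or
  lies in the old part.\<close>

lemma add_layer: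
  fixes L :: "cube_vertex \<times> nat \<Rightarrow> 'c set"
  assumes c: "degenerate_colouring grid_nbrs L (4 * n) (cube \<times> {..<n}) c"
    and L: "\<And>q. q \<in> cube \<Longrightarrow> card (L (q, n)) = 2"
  shows "\<exists>d. degenerate_colouring grid_nbrs L (4 * Suc n) (cube \<times> {..<Suc n}) d"
proof -
  define f :: "nat \<Rightarrow> nat \<Rightarrow> nat \<Rightarrow> cube_vertex \<times> nat" where "f x y z = (((x, y), z), n)" for x y z
  \<comment> \<open>For \<open>n = 0\<close> these are arbitrary colours; \<open>face_leaf\<close>
    refers to them only for positive \<open>n\<close>.\<close>
  define p where "p x y z = c (((x, y), z), n - 1)" for x y z :: nat
  have "card (L (f x y z)) = 2" if "x < 2" "y < 2" "z < 2" for x y z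
    using L that by (simp add: f_def cube_def)
  note card = this[of 0 0 0] this[of 1 0 0] this[of 1 1 0] this[of 0 1 0]
    this[of 0 0 1] this[of 1 0 1] this[of 1 1 1] this[of 0 1 1]
  obtain x0 x1 x2 x3 y0 y1 y2 y3 where
    xy: "x0 \<in> L (f 0 0 0)" "x1 \<in> L (f 1 0 0)" "x2 \<in> L (f 1 1 0)" "x3 \<in> L (f 0 1 0)"
      "y0 \<in> L (f 0 0 1)" "y1 \<in> L (f 1 0 1)" "y2 \<in> L (f 1 1 1)" "y3 \<in> L (f 0 1 1)"
    and ne: "x0 \<noteq> y0" "x1 \<noteq> y1" "x2 \<noteq> y2" "x3 \<noteq> y3"
    and good: "good_face x0 x1 x2 x3 (p 0 0 0) (p 1 0 0) (p 1 1 0) (p 0 1 0)"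
      "good_face y0 y1 y2 y3 (p 0 0 1) (p 1 0 1) (p 1 1 1) (p 0 1 1)"
    using good_faces_exist[OF card(1-8)[simplified],
      of "p 0 0 0" "p 1 0 0" "p 1 1 0" "p 0 1 0" "p 0 0 1" "p 1 0 1" "p 1 1 1" "p 0 1 1"]
    by (auto simp: One_nat_def)
  define d where "d = c(f 0 0 0 := x0, f 1 0 0 := x1, f 1 1 0 := x2, f 0 1 0 := x3,
     f 0 0 1 := y0, f 1 0 1 := y1, f 1 1 1 := y2, f 0 1 1 := y3)"
  have df: "d (f 0 0 0) = x0" "d (f 1 0 0) = x1" "d (f 1 1 0) = x2" "d (f 0 1 0) = x3"
    "d (f 0 0 1) = y0" "d (f 1 0 1) = y1" "d (f 1 1 1) = y2" "d (f 0 1 1) = y3"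
    by (simp_all add: d_def f_def)
  have dV: "d v = c v" if "snd v \<noteq> n" for v
    using that by (auto simp: d_def f_def)
  have dne: "d (f x y 0) \<noteq> d (f x y 1)" if "x < 2" "y < 2" for x y
    using ne that unfolding less_2_cases_iff One_nat_def[symmetric]
      by (elim disjE) (simp_all only: df simp_thms not_False_eq_True)
  have layer: "cube \<times> {n} = {f 0 0 0, f 1 0 0, f 1 1 0, f 0 1 0, f 0 0 1, f 1 0 1, f 1 1 1, f 0 1 1}"
    by (simp add: cube_eq f_def)
  have split: "cube \<times> {..<Suc n} = cube \<times> {..<n} \<union> cube \<times> {n}"
    by (auto simp: less_Suc_eq)
  have "card {v \<in> cube \<times> {..<Suc n}. d v = a} \<le> 4 * Suc n" for a
  proof -
    \<comment> \<open>The one vertex that can have colour \<open>a\<close> on the edge joining the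
      faces at position \<open>(x, y)\<close>.\<close>
    let ?r = "\<lambda>x y. if d (f x y 0) = a then f x y 0 else f x y 1"
    have "{v \<in> cube \<times> {..<n}. d v = a} = {v \<in> cube \<times> {..<n}. c v = a}"
      using dV by fastforce
    then have "{v \<in> cube \<times> {..<Suc n}. d v = a} =
        {v \<in> cube \<times> {..<n}. c v = a} \<union> {v \<in> cube \<times> {n}. d v = a}"
      unfolding split by blast
    then have "card {v \<in> cube \<times> {..<Suc n}. d v = a} \<le>
        card {v \<in> cube \<times> {..<n}. c v = a} + card {v \<in> cube \<times> {n}. d v = a}"
      by (simp add: card_Un_le)
    moreover have "card {v \<in> cube \<times> {..<n}. c v = a} \<le> 4 * n"
      using c by (simp add: degenerate_colouring_def)
    moreover have "{v \<in> cube \<times> {n}. d v = a} \<subseteq> set [?r 0 0, ?r 1 0, ?r 1 1, ?r 0 1]"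
    proof
      fix v assume "v \<in> {v \<in> cube \<times> {n}. d v = a}"
      then obtain x y z where v: "v = f x y z" "x < 2" "y < 2" "z < 2" "d (f x y z) = a"
        by (auto simp: cube_def f_def)
      then have "v = ?r x y" using dne[of x y] by (auto simp: less_2_cases_iff)
      then show "v \<in> set [?r 0 0, ?r 1 0, ?r 1 1, ?r 0 1]"
        using v(2,3) unfolding less_2_cases_iff One_nat_def[symmetric]
          by (elim disjE) (simp_all only: list.set insert_iff simp_thms)
    qed
    then have "card {v \<in> cube \<times> {n}. d v = a} \<le> card (set [?r 0 0, ?r 1 0, ?r 1 1, ?r 0 1])"
      by (intro card_mono) auto
    then have "card {v \<in> cube \<times> {n}. d v = a} \<le> 4"
      using card_length[of "[?r 0 0, ?r 1 0, ?r 1 1, ?r 0 1]"] by simp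
    ultimately show ?thesis by simp
  qed
  moreover have "d v \<in> L v" if "v \<in> cube \<times> {..<Suc n}" for v
  proof (cases "v \<in> cube \<times> {n}")
    case True
    then show ?thesis using xy unfolding layer by (elim insertE emptyE) (simp_all only: df)
  next
    case False
    then have "v \<in> cube \<times> {..<n}" using that by (auto simp: less_Suc_eq)
    then show ?thesis using dV[of v] c by (auto simp: degenerate_colouring_def)
  qed
  moreover have "\<exists>v\<in>W. card (grid_nbrs v \<inter> W) \<le> 1"
    if W: "W \<subseteq> cube \<times> {..<Suc n}" "W \<noteq> {}" "\<forall>u\<in>W. \<forall>v\<in>W. d u = d v" for W
  proof -
    have upper: "(q, Suc n) \<notin> W" for q using W(1) by auto
    have cross: "f x y 0 \<notin> W \<or> f x y 1 \<notin> W" if "x < 2" "y < 2" for x y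
      using dne[OF that] W(3) by blast
    have mono: "d u = d v" if "u \<in> W" "v \<in> W" for u v using W(3) that by blast
    have cross0: "(((x, y), 1), n) \<notin> W" if "(((x, y), 0), n) \<in> W" "x < 2" "y < 2" for x y
      using cross[OF that(2,3)] that(1) unfolding f_def by blast
    have cross1: "(((x, y), 0), n) \<notin> W" if "(((x, y), 1), n) \<in> W" "x < 2" "y < 2" for x y
      using cross[OF that(2,3)] that(1) unfolding f_def by blast
    have below: "d (((x, y), z), n - 1) = p x y z" if "0 < n" for x y z
      using dV that by (simp add: p_def)
    consider "f 0 0 0 \<in> W \<or> f 1 0 0 \<in> W \<or> f 1 1 0 \<in> W \<or> f 0 1 0 \<in> W"
      | "f 0 0 1 \<in> W \<or> f 1 0 1 \<in> W \<or> f 1 1 1 \<in> W \<or> f 0 1 1 \<in> W"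
      | "W \<subseteq> cube \<times> {..<n}"
      using W(1) unfolding split layer by blast
    then show ?thesis
    proof cases
      case 1
      show ?thesis
      proof (rule face_leaf[where n = n and d = d])
        show "cube_nbrs ((0, 0), 0) = {((0, 1), 0), ((1, 0), 0), ((0, 0), 1)}"
          "cube_nbrs ((1, 0), 0) = {((0, 0), 0), ((1, 1), 0), ((1, 0), 1)}"
          "cube_nbrs ((1, 1), 0) = {((1, 0), 0), ((0, 1), 0), ((1, 1), 1)}"
          "cube_nbrs ((0, 1), 0) = {((1, 1), 0), ((0, 0), 0), ((0, 1), 1)}"
          by auto
        show "good_face (d (((0, 0), 0), n)) (d (((1, 0), 0), n)) (d (((1, 1), 0), n)) (d (((0, 1), 0), n))
            (p 0 0 0) (p 1 0 0) (p 1 1 0) (p 0 1 0)"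
          using good by (simp only: df[unfolded f_def])
        show "(((0, 0), 0), n) \<in> W \<or> (((1, 0), 0), n) \<in> W \<or> (((1, 1), 0), n) \<in> W \<or>
            (((0, 1), 0), n) \<in> W"
          using 1 unfolding f_def .
      qed ((erule cross0; simp) | rule upper | (rule mono; assumption) | (erule below))+
    next
      case 2
      show ?thesis
      proof (rule face_leaf[where n = n and d = d])
        show "cube_nbrs ((0, 0), 1) = {((0, 1), 1), ((1, 0), 1), ((0, 0), 0)}"
          "cube_nbrs ((1, 0), 1) = {((0, 0), 1), ((1, 1), 1), ((1, 0), 0)}"
          "cube_nbrs ((1, 1), 1) = {((1, 0), 1), ((0, 1), 1), ((1, 1), 0)}"
          "cube_nbrs ((0, 1), 1) = {((1, 1), 1), ((0, 0), 1), ((0, 1), 0)}"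
          by auto
        show "good_face (d (((0, 0), 1), n)) (d (((1, 0), 1), n)) (d (((1, 1), 1), n)) (d (((0, 1), 1), n))
            (p 0 0 1) (p 1 0 1) (p 1 1 1) (p 0 1 1)"
          using good by (simp only: df[unfolded f_def])
        show "(((0, 0), 1), n) \<in> W \<or> (((1, 0), 1), n) \<in> W \<or> (((1, 1), 1), n) \<in> W \<or>
            (((0, 1), 1), n) \<in> W"
          using 2 unfolding f_def .
      qed ((erule cross1; simp) | rule upper | (rule mono; assumption) | (erule below))+
    next
      case 3
      then have "snd v \<noteq> n" if "v \<in> W" for v using that by auto
      then have "c u = c v" if "u \<in> W" "v \<in> W" for u v
        using mono[OF that] dV that by simp
      moreover have "mono_degenerate grid_nbrs (cube \<times> {..<n}) c"
        using c by (simp add: degenerate_colouring_def)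
      ultimately show ?thesis using mono_degenerateD 3 W(2) by metis
    qed
  qed
  ultimately have "degenerate_colouring grid_nbrs L (4 * Suc n) (cube \<times> {..<Suc n}) d"
    unfolding degenerate_colouring_def mono_degenerate_def by blast
  then show ?thesis by blast
qed

lemma two_colours:
  assumes "\<And>v. v \<in> cube \<times> {..<n} \<Longrightarrow> card (L v) = 2"
  shows "\<exists>c. degenerate_colouring grid_nbrs L (4 * n) (cube \<times> {..<n}) c"
  using assms
proof (induction n)
  case 0
  show ?case using degenerate_colouring_empty by fastforce
next
  case (Suc n)
  then obtain c where "degenerate_colouring grid_nbrs L (4 * n) (cube \<times> {..<n}) c" by fastforce
  then show ?case by (rule add_layer) (use Suc.prems in auto)
qed

subsection \<open>At least three colours per list\<close>

lemma card_le_lengthI: "X \<subseteq> set xs \<Longrightarrow> card X \<le> length xs"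
  using card_mono[of "set xs" X] card_length[of xs] by simp

lemma cube_nbrs_sym: "q \<in> cube \<Longrightarrow> r \<in> cube_nbrs q \<Longrightarrow> q \<in> cube_nbrs r"
  by (auto simp: cube_eq)

lemma card_cube_nbrs_le: "card (cube_nbrs q) \<le> 3"
  by (cases q rule: cube_nbrs.cases) (simp add: card_insert_if)

lemma finite_cube_nbrs: "finite (cube_nbrs q)"
  by (cases q rule: cube_nbrs.cases) simp

lemma finite_cube: "finite cube"
  by (simp add: cube_def)

text \<open>Connectivity of the cube: the listed steps form a directed 4-cycle and a directed
  6-cycle that share an arc and together visit all eight vertices.\<close>

lemma cube_nbrs_closed:
  assumes "\<And>q. q \<in> T \<Longrightarrow> cube_nbrs q \<subseteq> T" "q \<in> T" "q \<in> cube"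
  shows "cube \<subseteq> T"
proof -
  have step: "r \<in> T" if "p \<in> T" "r \<in> cube_nbrs p" for p r using assms(1) that by blast
  have "((1, 1), 1) \<in> T \<or> ((1, 1), 0) \<in> T \<or> ((1, 0), 1) \<in> T \<or> ((0, 1), 1) \<in> T \<or>
      ((0, 0), 0) \<in> T \<or> ((0, 0), 1) \<in> T \<or> ((0, 1), 0) \<in> T \<or> ((1, 0), 0) \<in> T"
    using assms(2,3) unfolding cube_eq by blast
  moreover have
    "((0, 0), 0) \<in> T \<Longrightarrow> ((1, 0), 0) \<in> T" "((0, 0), 0) \<in> T \<Longrightarrow> ((0, 0), 1) \<in> T"
    "((1, 0), 0) \<in> T \<Longrightarrow> ((1, 1), 0) \<in> T" "((1, 1), 0) \<in> T \<Longrightarrow> ((0, 1), 0) \<in> T"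
    "((0, 1), 0) \<in> T \<Longrightarrow> ((0, 0), 0) \<in> T" "((0, 0), 1) \<in> T \<Longrightarrow> ((1, 0), 1) \<in> T"
    "((1, 0), 1) \<in> T \<Longrightarrow> ((1, 1), 1) \<in> T" "((1, 1), 1) \<in> T \<Longrightarrow> ((0, 1), 1) \<in> T"
    "((0, 1), 1) \<in> T \<Longrightarrow> ((0, 1), 0) \<in> T"
    by (erule step, simp)+
  ultimately show ?thesis unfolding cube_eq by blast
qed

lemma card_layer_le: "card ({q} \<times> {m. m = Suc l \<or> l = Suc m}) \<le> 2"
proof -
  have "{q} \<times> {m. m = Suc l \<or> l = Suc m} \<subseteq> set [(q, Suc l), (q, l - 1)]" by auto
  from card_le_lengthI[OF this] show ?thesis by simp
qed

lemma card_grid_nbrs_le: "card (grid_nbrs v \<inter> X) \<le> 5"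
proof -
  obtain q l where v: "v = (q, l)" by fastforce
  have "finite ({q} \<times> {m. m = Suc l \<or> l = Suc m})"
    by (rule finite_subset[of _ "{q} \<times> {..Suc l}"]) auto
  then have fin: "finite (grid_nbrs v)" by (simp add: grid_nbrs_def v finite_cube_nbrs)
  have "card (grid_nbrs v) \<le> card (cube_nbrs q \<times> {l}) + card ({q} \<times> {m. m = Suc l \<or> l = Suc m})"
    unfolding grid_nbrs_def v by (simp add: card_Un_le)
  also have "\<dots> \<le> 3 + 2"
    using card_cube_nbrs_le[of q] card_layer_le[of q l] by (simp add: card_cartesian_product)
  finally have "card (grid_nbrs v) \<le> 5" by simp
  then show ?thesis using card_mono[OF fin, of "grid_nbrs v \<inter> X"] by simp
qed

lemma grid_nbrs_irrefl: "fst v \<in> cube \<Longrightarrow> v \<notin> grid_nbrs v"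
  by (auto simp: grid_nbrs_def cube_eq)

text \<open>Outside its own level a top vertex can only have the neighbour below. At
  \<open>t = 0\<close> truncation inserts the vertex itself, which just enlarges the upper
  bound.\<close>

lemma grid_nbrs_top_subset:
  assumes "V \<subseteq> UNIV \<times> {..t}"
  shows "grid_nbrs (q, t) \<inter> (V - Z \<times> {t}) \<subseteq> insert (q, t - 1) ((cube_nbrs q - Z) \<times> {t})"
  using assms by (auto simp: grid_nbrs_def)

lemma card_grid_nbrs_top:
  assumes "V \<subseteq> UNIV \<times> {..t}"
  shows "card (grid_nbrs (q, t) \<inter> V) \<le> Suc (card (cube_nbrs q \<inter> {r. (r, t) \<in> V}))"
proof -
  let ?C = "cube_nbrs q \<inter> {r. (r, t) \<in> V}"
  have "grid_nbrs (q, t) \<inter> V \<subseteq> insert (q, t - 1) (?C \<times> {t})"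
    using assms by (auto simp: grid_nbrs_def)
  then have "card (grid_nbrs (q, t) \<inter> V) \<le> card (insert (q, t - 1) (?C \<times> {t}))"
    by (rule card_mono[rotated]) (simp add: finite_cube_nbrs)
  also have "\<dots> \<le> Suc (card (?C \<times> {t}))" by (simp add: card_insert_if finite_cube_nbrs)
  finally show ?thesis by (simp add: card_cartesian_product)
qed

lemma card_grid_nbrs_top_le:
  assumes "V \<subseteq> UNIV \<times> {..t}"
  shows "card (grid_nbrs (q, t) \<inter> V) \<le> 4"
proof -
  have "card (cube_nbrs q \<inter> {r. (r, t) \<in> V}) \<le> card (cube_nbrs q)"
    by (intro card_mono) (simp_all add: finite_cube_nbrs)
  then show ?thesis using card_grid_nbrs_top[OF assms, of q] card_cube_nbrs_le[of q] by simp
qed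

section \<open>Groups of vertices that can be removed near the top\<close>

lemma top_level:
  fixes V :: "(cube_vertex \<times> nat) set"
  assumes "finite V" "V \<noteq> {}"
  obtains q t where "(q, t) \<in> V" "V \<subseteq> UNIV \<times> {..t}"
proof -
  have "Max (snd ` V) \<in> snd ` V" using assms by simp
  then obtain q where "(q, Max (snd ` V)) \<in> V" by auto
  moreover have "snd v \<le> Max (snd ` V)" if "v \<in> V" for v using assms(1) that by simp
  then have "V \<subseteq> UNIV \<times> {..Max (snd ` V)}" by fastforce
  ultimately show thesis using that by blast
qed

text \<open>\<open>x1\<close> and \<open>x2\<close> are the two vertices with few old neighbours
  needed by the greedy extension. \<open>S\<close> may have fewer than \<open>k\<close> elements,
  since enlarging it only lowers these numbers.\<close>

lemma exists_peelable_set: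
  assumes V: "finite V" "V \<subseteq> cube \<times> UNIV" and k: "3 \<le> k" "k \<le> card V"
  shows "(\<exists>S x1 x2. S \<subseteq> V \<and> card S \<le> k \<and> x1 \<in> S \<and> x2 \<in> S \<and> x1 \<noteq> x2 \<and>
            card (grid_nbrs x1 \<inter> (V - S)) \<le> 1 \<and> card (grid_nbrs x2 \<inter> (V - S)) \<le> 3) \<or>
         (k = 3 \<and> (\<exists>t. cube \<times> {t} \<subseteq> V \<and> V \<subseteq> cube \<times> {..t}))"
proof -
  have "V \<noteq> {}" using k by auto
  then obtain q\<^sub>0 t where top: "(q\<^sub>0, t) \<in> V" "V \<subseteq> UNIV \<times> {..t}" by (rule top_level[OF V(1)])
  define T where "T = {q. (q, t) \<in> V}"
  have T: "T \<subseteq> cube" using V(2) by (auto simp: T_def)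
  have fin: "finite (grid_nbrs v \<inter> V)" for v using V(1) by simp
  have finc: "finite (cube_nbrs q \<inter> T)" for q by (simp add: finite_cube_nbrs)
  have deg: "card (grid_nbrs (q, t) \<inter> V) \<le> Suc (card (cube_nbrs q \<inter> T))" for q
    using card_grid_nbrs_top[OF top(2)] by (simp add: T_def)
  have remove: "card (grid_nbrs x \<inter> (V' - S)) \<le> d"
    if "y \<in> S" "y \<in> grid_nbrs x" "y \<in> V'" "card (grid_nbrs x \<inter> V') \<le> Suc d" "V' \<subseteq> V" for x y S V' d
  proof -
    have "card (grid_nbrs x \<inter> (V' - S)) \<le> card (grid_nbrs x \<inter> V' - {y})"
      using that(1) finite_subset[OF that(5) V(1)] by (intro card_mono) auto
    then show ?thesis using that by simp
  qed
  consider (mid) q where "q \<in> T" "cube_nbrs q \<inter> T \<noteq> {}" "Suc (card (cube_nbrs q \<inter> T)) \<le> k"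
    | (isolated) q where "q \<in> T" "cube_nbrs q \<inter> T = {}"
    | (full) "\<And>q. q \<in> T \<Longrightarrow> k \<le> card (cube_nbrs q \<inter> T)"
    by (meson not_less_eq_eq)
  then show ?thesis
  proof cases
    case mid
    then obtain r where r: "r \<in> cube_nbrs q" "r \<in> T" by blast
    \<comment> \<open>Afterwards \<open>q\<close> keeps at most the neighbour below, while
      \<open>r\<close> has at most four neighbours in \<open>V\<close> and loses
      \<open>q\<close>.\<close>
    let ?S = "insert (q, t) ((cube_nbrs q \<inter> T) \<times> {t})"
    have "q \<notin> cube_nbrs q" using grid_nbrs_irrefl[of "(q, t)"] mid(1) T
      by (auto simp: grid_nbrs_def)
    then have "card ?S = Suc (card (cube_nbrs q \<inter> T))"
      using finc by (subst card_insert_disjoint) (auto simp: card_cartesian_product)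
    then have "card ?S \<le> k" using mid by simp
    moreover have "card (grid_nbrs (q, t) \<inter> (V - ?S)) \<le> 1"
    proof -
      have "grid_nbrs (q, t) \<inter> (V - ?S) \<subseteq> set [(q, t - 1)]"
        using top(2) by (auto simp: grid_nbrs_def T_def)
      from card_le_lengthI[OF this] show ?thesis by simp
    qed
    moreover have "card (grid_nbrs (r, t) \<inter> (V - ?S)) \<le> 3"
    proof (rule remove[of "(q, t)"])
      have "q \<in> cube_nbrs r" using cube_nbrs_sym[of q r] r(1) mid(1) T by blast
      then show "(q, t) \<in> grid_nbrs (r, t)" by (simp add: grid_nbrs_def)
      show "card (grid_nbrs (r, t) \<inter> V) \<le> Suc 3" using card_grid_nbrs_top_le[OF top(2)] by simp
    qed (use mid(1) in \<open>auto simp: T_def\<close>)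
    moreover have "?S \<subseteq> V" using mid(1) by (auto simp: T_def)
    moreover have "(q, t) \<noteq> (r, t)" using \<open>q \<notin> cube_nbrs q\<close> r(1) by auto
    moreover have "(r, t) \<in> ?S" using r by simp
    ultimately show ?thesis by blast
  next
    case isolated
    \<comment> \<open>\<open>q\<close> has at most the neighbour below. The second vertex is a
      highest one of the rest, with at most four neighbours there; one of them joins
      \<open>S\<close> if there is any.\<close>
    let ?V = "V - {(q, t)}"
    have "?V \<noteq> {}" using k V(1) card_mono[of "{(q, t)}" V] by auto
    then obtain q' t' where x2: "(q', t') \<in> ?V" "?V \<subseteq> UNIV \<times> {..t'}"
      using V(1) top_level[of ?V] by blast
    have deg1: "card (grid_nbrs (q, t) \<inter> (V - S)) \<le> 1" for S
    proof -
      have "card (grid_nbrs (q, t) \<inter> (V - S)) \<le> card (grid_nbrs (q, t) \<inter> V)"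
        using fin by (intro card_mono) auto
      then show ?thesis using deg[of q] isolated(2) by simp
    qed
    have deg2: "card (grid_nbrs (q', t') \<inter> ?V) \<le> Suc 3" using card_grid_nbrs_top_le[OF x2(2)]
      by simp
    show ?thesis
    proof (cases "grid_nbrs (q', t') \<inter> ?V = {}")
      case True
      let ?S = "{(q, t), (q', t')}"
      have "grid_nbrs (q', t') \<inter> (V - ?S) = {}" using True by blast
      then have "card (grid_nbrs (q', t') \<inter> (V - ?S)) \<le> 3" by simp
      moreover have "card ?S \<le> k" using k(1) card_length[of "[(q, t), (q', t')]"] by simp
      moreover have "?S \<subseteq> V" "(q, t) \<noteq> (q', t')" using isolated x2 by (auto simp: T_def)
      ultimately show ?thesis using deg1 by blast
    next
      case False
      then obtain y where y: "y \<in> grid_nbrs (q', t')" "y \<in> ?V" by blast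
      let ?S = "{(q, t), (q', t'), y}"
      have "card (grid_nbrs (q', t') \<inter> (?V - ?S)) \<le> 3"
        by (rule remove[where y = y and V' = ?V]) (use y deg2 in auto)
      moreover have "?V - ?S = V - ?S" by blast
      ultimately have "card (grid_nbrs (q', t') \<inter> (V - ?S)) \<le> 3" by simp
      moreover have "card ?S \<le> k" using k(1) card_length[of "[(q, t), (q', t'), y]"] by simp
      moreover have "?S \<subseteq> V" "(q, t) \<noteq> (q', t')" using isolated x2 y by (auto simp: T_def)
      ultimately show ?thesis using deg1 by blast
    qed
  next
    case full
    \<comment> \<open>Cube degrees are at most 3, so \<open>k = 3\<close> and \<open>T\<close> is
      closed under neighbours; by connectivity it is the whole cube.\<close>
    have sub: "cube_nbrs q \<subseteq> T" "k \<le> 3" if "q \<in> T" for q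
    proof -
      have le: "card (cube_nbrs q \<inter> T) \<le> card (cube_nbrs q)"
        using finite_cube_nbrs by (intro card_mono) auto
      then show "k \<le> 3" using full[OF that] card_cube_nbrs_le[of q] by simp
      have "cube_nbrs q \<inter> T = cube_nbrs q"
        using le full[OF that] card_cube_nbrs_le[of q] k(1) finite_cube_nbrs
          by (intro card_subset_eq) auto
      then show "cube_nbrs q \<subseteq> T" by blast
    qed
    have q\<^sub>0: "q\<^sub>0 \<in> T" using top(1) by (simp add: T_def)
    then have "cube \<subseteq> T" using cube_nbrs_closed[of T q\<^sub>0] sub(1) T by blast
    then have "cube \<times> {t} \<subseteq> V" by (auto simp: T_def)
    moreover have "V \<subseteq> cube \<times> {..t}" using V(2) top(2) by blast
    moreover have "k = 3" using sub(2)[OF q\<^sub>0] k(1) by simp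
    ultimately show ?thesis by blast
  qed
qed

text \<open>In the order \<open>x1\<close>, \<open>x2\<close>, rest, at most 1, 3 and 5 old
  neighbours leave at least \<open>k\<close>, \<open>k - 1\<close> and \<open>k - 2\<close> colours,
  as the greedy choice requires.\<close>

lemma colour_peelable_set:
  assumes c: "degenerate_colouring grid_nbrs L m (V - S) c"
    and V: "finite V" "V \<subseteq> cube \<times> UNIV" and L: "\<And>v. v \<in> V \<Longrightarrow> card (L v) = k"
    and S: "S \<subseteq> V" "card S = k" "x1 \<in> S" "x2 \<in> S" "x1 \<noteq> x2"
      "card (grid_nbrs x1 \<inter> (V - S)) \<le> 1" "card (grid_nbrs x2 \<inter> (V - S)) \<le> 3"
  shows "\<exists>d. degenerate_colouring grid_nbrs L (Suc m) V d"
proof -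
  have "finite S" using S(1) V(1) by (rule finite_subset)
  then obtain ys where ys: "set ys = S - {x1, x2}" "distinct ys"
    using finite_distinct_list[of "S - {x1, x2}"] by auto
  let ?xs = "x1 # x2 # ys"
  let ?A = "\<lambda>x. L x \<inter> unrepeated_colours c (grid_nbrs x \<inter> (V - S))"
  have xs: "set ?xs = S" "distinct ?xs" using ys S by auto
  then have len: "length ?xs = k" using S(2) distinct_card by metis
  have A: "k - j \<le> card (?A x)"
    if "x \<in> S" "card (grid_nbrs x \<inter> (V - S)) \<le> Suc (2 * j)" for x j
    using card_unrepeated_colours[OF _ that(2), of "L x" c] V(1) L[of x] that(1) S(1) by auto
  have "length ?xs - i \<le> card (?A (?xs ! i))" if i: "i < length ?xs" for i
  proof -
    have in_S: "?xs ! i \<in> S" using nth_mem[OF i] unfolding xs(1) .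
    consider "i = 0" | "i = 1" | "2 \<le> i" by linarith
    then show ?thesis
    proof cases
      case 1
      then show ?thesis using A[of x1 0] S(3,6) len by simp
    next
      case 2
      then show ?thesis using A[of x2 1] S(4,7) len by simp
    next
      case 3
      have "k - 2 \<le> card (?A (?xs ! i))"
        using A[OF in_S, of 2] card_grid_nbrs_le[of "?xs ! i" "V - S"] by simp
      then show ?thesis using 3 len by linarith
    qed
  qed
  then have "\<exists>d. degenerate_colouring grid_nbrs L (Suc m) ((V - S) \<union> set ?xs) d \<and>
      (\<forall>v\<in>V - S. d v = c v) \<and>
      (\<forall>x\<in>set ?xs. d x \<in> ?A x)"
  proof (intro extend_by_distinct_colours[OF c _ xs(2)])
    show "x \<notin> grid_nbrs x" if "x \<in> set ?xs" for x
      using grid_nbrs_irrefl[of x] that xs(1) S(1) V(2) by (cases x) auto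
  qed (use V(1) xs(1) in auto)
  moreover have "(V - S) \<union> set ?xs = V" using xs(1) S(1) by auto
  ultimately show ?thesis by auto
qed

text \<open>The group \<open>Y\<close> is added first. Its vertex \<open>v 0 0 1\<close> also
  avoids the colour of the vertex below \<open>v 0 0 0\<close>, so that the two old neighbours of
  \<open>v 0 0 0\<close> have different colours when \<open>X\<close> is added.\<close>

lemma colour_full_top:
  fixes t :: nat
  defines "v \<equiv> \<lambda>x y z. ((x :: nat, y :: nat), z :: nat)"
  defines "X \<equiv> {v 0 0 0, v 1 0 0, v 0 1 0}" and "Y \<equiv> {v 1 1 0, v 1 1 1, v 0 0 1}"
  defines "P \<equiv> (X \<union> Y) \<times> {t}"
  assumes c: "degenerate_colouring grid_nbrs L m (V - P) c"
    and V: "finite V" "cube \<times> {t} \<subseteq> V" "V \<subseteq> cube \<times> {..t}" and L: "\<And>v. v \<in> V \<Longrightarrow> card (L v) = 3"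
  shows "\<exists>d. degenerate_colouring grid_nbrs L (Suc (Suc m)) V d"
proof -
  let ?ys = "[(v 1 1 0, t), (v 1 1 1, t), (v 0 0 1, t)]"
  let ?xs = "[(v 0 0 0, t), (v 1 0 0, t), (v 0 1 0, t)]"
  let ?w = "(v 0 0 0, t - 1)"
  define V\<^sub>0 where "V\<^sub>0 = V - P"
  define V\<^sub>1 where "V\<^sub>1 = V - X \<times> {t}"
  \<comment> \<open>Excluding \<open>c ?w\<close> costs \<open>v 0 0 1\<close> at most one further
    colour; it comes last in \<open>?ys\<close>, where one colour suffices. For \<open>t = 0\<close>
    this is the arbitrary value of \<open>c\<close> at \<open>v 0 0 0\<close> itself.\<close>
  define A where "A x = L x \<inter> unrepeated_colours c (grid_nbrs x \<inter>
      V\<^sub>0) - (if x = (v 0 0 1, t) then {c ?w} else {})" for x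
  have "X \<union> Y \<subseteq> cube" by (auto simp: X_def Y_def v_def cube_def)
  then have P: "P \<subseteq> V" using V(2) unfolding P_def by blast
  have P_mem: "(v 1 1 0, t) \<in> P" "(v 1 1 1, t) \<in> P" "(v 0 0 1, t) \<in> P"
    "(v 0 0 0, t) \<in> P" "(v 1 0 0, t) \<in> P" "(v 0 1 0, t) \<in> P"
    by (simp_all add: P_def X_def Y_def)
  have Y: "set ?ys = Y \<times> {t}" and X: "set ?xs = X \<times> {t}"
    by (simp_all add: X_def Y_def)
  have "X \<inter> Y = {}" by (simp add: X_def Y_def v_def)
  then have V\<^sub>1: "V\<^sub>0 \<union> set ?ys = V\<^sub>1" "V\<^sub>1 \<union> set ?xs = V" "set ?ys \<inter> V\<^sub>0 = {}" "set ?xs \<inter> V\<^sub>1 = {}"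
    using P unfolding V\<^sub>0_def V\<^sub>1_def P_def X Y by blast+
  have irrefl: "x \<notin> grid_nbrs x" if "x \<in> P" for x
  proof (rule grid_nbrs_irrefl)
    have "x \<in> cube \<times> {..t}" using that P V(3) by blast
    then show "fst x \<in> cube" by auto
  qed
  have "V \<subseteq> UNIV \<times> {..t}" using V(3) by blast
  note top = grid_nbrs_top_subset[OF this]
  have fin: "finite V\<^sub>0" "finite V\<^sub>1" using V(1) by (simp_all add: V\<^sub>0_def V\<^sub>1_def)
  have L3: "card (L x) = 3" if "x \<in> P" for x using L P that by blast
  have nbrs: "grid_nbrs (v 1 1 0, t) \<inter> V\<^sub>0 \<subseteq> set [(v 1 1 0, t - 1)]"
    "grid_nbrs (v 1 1 1, t) \<inter> V\<^sub>0 \<subseteq> set [(v 0 1 1, t), (v 1 0 1, t), (v 1 1 1, t - 1)]"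
    "grid_nbrs (v 0 0 1, t) \<inter> V\<^sub>0 \<subseteq> set [(v 0 1 1, t), (v 1 0 1, t), (v 0 0 1, t - 1)]"
    using top[of "v 1 1 0" "X \<union> Y"] top[of "v 1 1 1" "X \<union> Y"] top[of "v 0 0 1" "X \<union> Y"]
    unfolding V\<^sub>0_def P_def by (simp_all add: X_def Y_def v_def insert_Diff_if insert_commute)
  have A: "2 - j \<le> card (A x)"
    if "x \<in> P" "card (grid_nbrs x \<inter> V\<^sub>0) \<le> Suc (2 * j)" for x j
  proof -
    have "3 - j \<le> card (L x \<inter> unrepeated_colours c (grid_nbrs x \<inter> V\<^sub>0))"
      using card_unrepeated_colours[OF _ that(2), of "L x" c] fin(1) L3[OF that(1)] by simp
    moreover have "card (L x \<inter> unrepeated_colours c (grid_nbrs x \<inter> V\<^sub>0)) - 1 \<le> card (A x)"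
      unfolding A_def using diff_card_le_card_Diff[of "{c ?w}"] by auto
    ultimately show ?thesis by linarith
  qed
  have A': "3 - j \<le> card (A x)"
    if "x \<in> P" "x \<noteq> (v 0 0 1, t)" "card (grid_nbrs x \<inter> V\<^sub>0) \<le> Suc (2 * j)" for x j
    using card_unrepeated_colours[OF _ that(3), of "L x" c] fin(1) L3[OF that(1)] that(2)
      by (simp add: A_def)
  have "length ?ys - i \<le> card (A (?ys ! i))" if "i < length ?ys" for i
  proof -
    consider "i = 0" | "i = 1" | "i = 2" using \<open>i < length ?ys\<close> by fastforce
    then show ?thesis
    proof cases
      case 1
      then show ?thesis using A'[of "(v 1 1 0, t)" 0] card_le_lengthI[OF nbrs(1)] P_mem
        by (simp add: v_def)
    next
      case 2
      then show ?thesis using A'[of "(v 1 1 1, t)" 1] card_le_lengthI[OF nbrs(2)] P_mem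
        by (simp add: v_def)
    next
      case 3
      then show ?thesis using A[of "(v 0 0 1, t)" 1] card_le_lengthI[OF nbrs(3)] P_mem by simp
    qed
  qed
  then have "\<exists>d. degenerate_colouring grid_nbrs L (Suc m) (V\<^sub>0 \<union> set ?ys) d \<and> (\<forall>v\<in>V\<^sub>0. d v = c v) \<and>
      (\<forall>x\<in>set ?ys. d x \<in> A x)"
  proof (intro extend_by_distinct_colours)
    show "degenerate_colouring grid_nbrs L m V\<^sub>0 c" using c by (simp add: V\<^sub>0_def)
    show "x \<notin> grid_nbrs x" if "x \<in> set ?ys" for x
      using irrefl[of x] that P_mem by auto
    show "distinct ?ys" by (simp add: v_def)
    show "set ?ys \<inter> V\<^sub>0 = {}" by (rule V\<^sub>1)
    show "A x \<subseteq> L x \<inter> unrepeated_colours c (grid_nbrs x \<inter> V\<^sub>0)" for x by (auto simp: A_def)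
  qed (use fin in auto)
  then obtain d where d: "degenerate_colouring grid_nbrs L (Suc m) V\<^sub>1 d" "\<And>v. v \<in> V\<^sub>0 \<Longrightarrow> d v = c v"
      "d (v 0 0 1, t) \<in> A (v 0 0 1, t)"
    unfolding V\<^sub>1(1) by auto
  let ?B = "\<lambda>x. L x \<inter> unrepeated_colours d (grid_nbrs x \<inter> V\<^sub>1)"
  have B: "3 - j \<le> card (?B x)"
    if "x \<in> P" "card (grid_nbrs x \<inter> V\<^sub>1) \<le> Suc (2 * j)" for x j
    using card_unrepeated_colours[OF _ that(2), of "L x" d] fin(2) L3[OF that(1)] by simp
  have nbrs1: "grid_nbrs (v 0 0 0, t) \<inter> V\<^sub>1 \<subseteq> {(v 0 0 1, t), ?w}"
    "grid_nbrs (v 1 0 0, t) \<inter> V\<^sub>1 \<subseteq> set [(v 1 1 0, t), (v 1 0 1, t), (v 1 0 0, t - 1)]"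
    using top[of "v 0 0 0" X] top[of "v 1 0 0" X]
    unfolding V\<^sub>1_def by (simp_all add: X_def v_def insert_Diff_if insert_commute)
  have "L (v 0 0 0, t) \<subseteq> unrepeated_colours d (grid_nbrs (v 0 0 0, t) \<inter> V\<^sub>1)"
  proof
    fix a
    let ?M = "{u \<in> grid_nbrs (v 0 0 0, t) \<inter> V\<^sub>1. d u = a}"
    have "\<not> ((v 0 0 1, t) \<in> ?M \<and> ?w \<in> ?M)"
    proof
      assume *: "(v 0 0 1, t) \<in> ?M \<and> ?w \<in> ?M"
      \<comment> \<open>A neighbour of \<open>v 0 0 0\<close> is not that vertex itself, so
        \<open>t\<close> is positive and \<open>?w\<close> is an old vertex, still coloured by
        \<open>c\<close>.\<close>
      then have "?w \<noteq> (v 0 0 0, t)" using irrefl[OF P_mem(4)] by auto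
      then have "?w \<in> V\<^sub>0" using * by (auto simp: V\<^sub>1_def V\<^sub>0_def P_def)
      then have "d ?w = c ?w" by (rule d(2))
      moreover have "d (v 0 0 1, t) \<noteq> c ?w" using d(3) by (simp add: A_def)
      ultimately show False using * by simp
    qed
    then have "?M \<subseteq> {(v 0 0 1, t)} \<or> ?M \<subseteq> {?w}" using nbrs1(1) by blast
    then obtain z where "?M \<subseteq> {z}" by (elim disjE)
    then have "?M \<subseteq> set [z]" by simp
    from card_le_lengthI[OF this] show "a \<in> unrepeated_colours d (grid_nbrs (v 0 0 0, t) \<inter> V\<^sub>1)"
      by (simp add: unrepeated_colours_def)
  qed
  then have B0: "?B (v 0 0 0, t) = L (v 0 0 0, t)" by blast
  have "length ?xs - i \<le> card (?B (?xs ! i))" if "i < length ?xs" for i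
  proof -
    consider "i = 0" | "i = 1" | "i = 2" using \<open>i < length ?xs\<close> by fastforce
    then show ?thesis
    proof cases
      case 1
      then show ?thesis using B0 L3[OF P_mem(4)] by simp
    next
      case 2
      then show ?thesis using B[of "(v 1 0 0, t)" 1] card_le_lengthI[OF nbrs1(2)] P_mem by simp
    next
      case 3
      then show ?thesis using B[of "(v 0 1 0, t)" 2] card_grid_nbrs_le[of
        "(v 0 1 0, t)" V\<^sub>1] P_mem by simp
    qed
  qed
  then have "\<exists>e. degenerate_colouring grid_nbrs L (Suc (Suc m)) (V\<^sub>1 \<union> set ?xs) e \<and>
      (\<forall>v\<in>V\<^sub>1. e v = d v) \<and>
      (\<forall>x\<in>set ?xs. e x \<in> ?B x)"
  proof (intro extend_by_distinct_colours[OF d(1) fin(2)])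
    show "x \<notin> grid_nbrs x" if "x \<in> set ?xs" for x
      using irrefl[of x] that P_mem by auto
    show "distinct ?xs" by (simp add: v_def)
    show "set ?xs \<inter> V\<^sub>1 = {}" by (rule V\<^sub>1)
  qed auto
  then show ?thesis unfolding V\<^sub>1(2) by blast
qed

text \<open>The induction runs over arbitrary finite sets, since peeling leaves incomplete levels.
  The bound is the rounded-up quotient of \<open>card V\<close> by \<open>k\<close>, which drops by
  one for every \<open>k\<close> vertices removed.\<close>

lemma at_least_three_colours:
  assumes "finite V" "V \<subseteq> cube \<times> UNIV" "3 \<le> k" "\<And>v. v \<in> V \<Longrightarrow> card (L v) = k"
  shows "\<exists>c. degenerate_colouring grid_nbrs L ((card V + k - 1) div k) V c"
  using assms(1,2,4)
proof (induction "card V" arbitrary: V rule: less_induct)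
  case less
  note V = less.prems(1,2) and L = less.prems(3)
  have IH: "\<exists>c. degenerate_colouring grid_nbrs L ((card V - card S + k - 1) div k) (V - S) c"
    if "S \<subseteq> V" "S \<noteq> {}" for S
  proof -
    have "finite S" using that V(1) finite_subset by blast
    have "card (V - S) = card V - card S" using that \<open>finite S\<close> by (simp add: card_Diff_subset)
    moreover have "card (V - S) < card V" using that V(1) by (intro psubset_card_mono) auto
    moreover have "\<exists>c. degenerate_colouring grid_nbrs L ((card (V - S) + k - 1) div k) (V - S) c"
      by (rule less.hyps) (use calculation(2) V L in auto)
    ultimately show ?thesis by simp
  qed
  have "card V = 0 \<or> card V < k \<or> k \<le> card V" by linarith
  then consider "V = {}" | "V \<noteq> {}" "card V < k" | "k \<le> card V" using V(1) by fastforce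
  then show ?case
  proof cases
    case 1
    then show ?thesis using degenerate_colouring_empty by fastforce
  next
    case 2
    \<comment> \<open>Fewer than \<open>k\<close> vertices receive pairwise distinct colours, as an
      extension of the empty colouring with class bound 0.\<close>
    obtain xs where xs: "set xs = V" "distinct xs" using finite_distinct_list V(1) by blast
    have "\<exists>d. degenerate_colouring grid_nbrs L (Suc 0) ({} \<union> set xs) d \<and>
        (\<forall>v\<in>{}. d v = undefined v) \<and>
      (\<forall>x\<in>set xs. d x \<in> L x)"
    proof (intro extend_by_distinct_colours)
      show "x \<notin> grid_nbrs x" if "x \<in> set xs" for x
        using grid_nbrs_irrefl[of x] that xs(1) V(2) by (cases x) auto
      show "length xs - i \<le> card (L (xs ! i))" if "i < length xs" for i
        using L[of "xs ! i"] nth_mem[OF that] xs 2(2) distinct_card[of xs] by simp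
      show "L x \<subseteq> L x \<inter> unrepeated_colours undefined (grid_nbrs x \<inter> {})" for x
        by (simp add: unrepeated_colours_def)
    qed (use xs degenerate_colouring_empty in auto)
    moreover have "(card V + k - 1) div k = Suc 0"
    proof (rule div_nat_eqI)
      have "0 < card V" using 2(1) V(1) by (simp add: card_gt_0_iff)
      then show "k * Suc 0 \<le> card V + k - 1" by simp
      show "card V + k - 1 < k * Suc (Suc 0)" using 2(2) by simp
    qed
    ultimately show ?thesis using xs(1) by auto
  next
    case 3
    from exists_peelable_set[OF V assms(3) 3] show ?thesis
    proof (elim disjE exE conjE)
      fix S x1 x2
      assume S: "S \<subseteq> V" "card S \<le> k" "x1 \<in> S" "x2 \<in> S" "x1 \<noteq> x2"
        "card (grid_nbrs x1 \<inter> (V - S)) \<le> 1" "card (grid_nbrs x2 \<inter> (V - S)) \<le> 3"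
      \<comment> \<open>Exactly \<open>k\<close> vertices must be removed for the bound to drop by
        one.\<close>
      obtain S' where S': "S \<subseteq> S'" "S' \<subseteq> V" "card S' = k"
        using exists_subset_between[OF S(2) 3 S(1) V(1)] by blast
      have mono: "card (grid_nbrs x \<inter> (V - S')) \<le> card (grid_nbrs x \<inter> (V - S))" for x
        using V(1) S'(1) by (intro card_mono) auto
      obtain c where c: "degenerate_colouring grid_nbrs L ((card V - k + k - 1) div k) (V - S') c"
        using IH[of S'] S' S(3) by auto
      have "\<exists>d. degenerate_colouring grid_nbrs L (Suc ((card V - k + k - 1) div k)) V d"
        using S S' mono[of x1] mono[of x2] by (intro colour_peelable_set[OF c V L]) auto
      moreover have "Suc ((card V - k + k - 1) div k) = (card V + k - 1) div k"
      proof -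
        have "card V + k - 1 = (card V - 1) + k" using 3 assms(3) by simp
        then show ?thesis using 3 assms(3) by (simp only: div_add_self2) simp
      qed
      ultimately show ?thesis by simp
    next
      fix t assume t: "k = 3" "cube \<times> {t} \<subseteq> V" "V \<subseteq> cube \<times> {..t}"
      let ?P = "({((0, 0), 0), ((1, 0), 0), ((0, 1), 0)} \<union>
          {((1, 1), 0), ((1, 1), 1), ((0, 0), 1)}) \<times> {t} :: (cube_vertex \<times> nat) set"
      have P: "?P \<subseteq> V" using t(2) by (auto simp: cube_eq)
      \<comment> \<open>Six vertices are two groups of three, matching the two units by which the
        bound grows.\<close>
      have cP: "card ?P = 6" by simp
      then have "6 \<le> card V" using card_mono[OF V(1) P] by simp
      obtain c where "degenerate_colouring grid_nbrs L ((card V - 6 + k - 1) div k) (V - ?P) c"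
        using IH[OF P] unfolding cP by auto
      then have "\<exists>d. degenerate_colouring grid_nbrs L (Suc (Suc ((card V - 6 + k - 1) div k))) V d"
        by (rule colour_full_top) (use V t L in auto)
      moreover have "Suc (Suc ((card V - 6 + k - 1) div k)) = (card V + k - 1) div k"
        using \<open>6 \<le> card V\<close> t(1) by (simp add: div_if)
      ultimately show ?thesis by simp
    qed
  qed
qed

subsection \<open>Acyclic colour classes\<close>

lemma (in pre_digraph) cas_tl_verts:
  "cas u p v \<Longrightarrow> p \<noteq> [] \<Longrightarrow> tl (awalk_verts u p) = map (head G) p"
  by (induction p arbitrary: u rule: list.induct) (auto simp: neq_Nil_conv awalk_verts_conv)

lemma (in pre_digraph) cas_nth:
  assumes "cas u p v" "i < length p"
  shows "tail G (p ! i) = (if i = 0 then u else head G (p ! (i - 1)))"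
  using assms
proof (induction p arbitrary: u i)
  case (Cons e p)
  then show ?case by (cases i) (auto simp: nth_Cons')
qed simp

lemma (in pre_digraph) cas_last: "cas u p v \<Longrightarrow> p \<noteq> [] \<Longrightarrow> head G (last p) = v"
  by (induction p arbitrary: u) (auto split: if_splits)

text \<open>The vertices of a cycle in a colour class would form a monochromatic set without a leaf:
  each has its predecessor and successor as neighbours.\<close>

lemma acyclic_colour_class:
  assumes N: "\<And>u v. (u, v) \<in> parcs G \<Longrightarrow> v \<in> N u \<and> u \<in> N v"
    and c: "mono_degenerate N (pverts G) c"
  shows "acyclic_graph (with_proj G \<restriction> colour_class (with_proj G) c x)"
  unfolding acyclic_graph_def
proof (rule notI, elim exE conjE)
  let ?H = "with_proj G \<restriction> colour_class (with_proj G) c x"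
  fix p assume p: "pre_digraph.cycle ?H p" "3 \<le> length p"
  let ?m = "length p"
  define h where "h i = snd (p ! i)" for i
  obtain u where u: "pre_digraph.awalk ?H u p u" "distinct (tl (pre_digraph.awalk_verts ?H u p))"
    "p \<noteq> []"
    using p(1) unfolding pre_digraph.cycle_def by blast
  then have cas: "pre_digraph.cas ?H u p u" and arcs: "set p \<subseteq> arcs ?H"
    by (simp_all add: pre_digraph.awalk_def)
  have "distinct (map snd p)"
    using u(2) pre_digraph.cas_tl_verts[OF cas u(3)] by simp
  then have inj: "h i = h j \<longleftrightarrow> i = j" if "i < ?m" "j < ?m" for i j
    using that by (simp add: h_def distinct_conv_nth) metis
  have arc: "(fst (p ! i), h i) \<in> parcs G" "h i \<in> colour_class (with_proj G) c x" if "i < ?m" for i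
    using arcs nth_mem[OF that] by (auto simp: h_def)
  have tail: "fst (p ! i) = h (if i = 0 then ?m - 1 else i - 1)" if "i < ?m" for i
    using pre_digraph.cas_nth[OF cas that] pre_digraph.cas_last[OF cas u(3)] u(3)
    by (simp add: h_def last_conv_nth)
  let ?W = "h ` {..<?m}"
  have "?W \<subseteq> pverts G" "\<forall>a\<in>?W. \<forall>b\<in>?W. c a = c b"
    using arc(2) by (auto simp: colour_class_def)
  moreover have "?W \<noteq> {}" using u(3) by auto
  ultimately obtain i where i: "i < ?m" "card (N (h i) \<inter> ?W) \<le> 1"
    using c unfolding mono_degenerate_def by blast
  \<comment> \<open>Indices are taken cyclically; length at least 3 makes predecessor and successor
    differ.\<close>
  let ?prev = "if i = 0 then ?m - 1 else i - 1" and ?next = "if Suc i = ?m then 0 else Suc i"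
  have bounds: "?prev < ?m" "?next < ?m" "?prev \<noteq> ?next" using i(1) p(2) by auto
  have "h ?prev \<in> N (h i)" using N[OF arc(1)[OF i(1)]] tail[OF i(1)] by simp
  moreover have "(if ?next = 0 then ?m - 1 else ?next - 1) = i" using i(1) by auto
  then have "fst (p ! ?next) = h i" using tail[OF bounds(2)] by argo
  then have "h ?next \<in> N (h i)" using N[OF arc(1)[OF bounds(2)]] by argo
  ultimately have "{h ?prev, h ?next} \<subseteq> N (h i) \<inter> ?W" using bounds by blast
  then have "card {h ?prev, h ?next} \<le> card (N (h i) \<inter> ?W)" by (rule card_mono[rotated]) simp
  moreover have "card {h ?prev, h ?next} = 2" using inj[OF bounds(1,2)] bounds(3) by simp
  ultimately show False using i(2) by simp
qed

lemma le_ceiling_divide: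
  assumes "0 < k" "a \<le> (n + k - 1) div k"
  shows "int a \<le> \<lceil>real n / real k\<rceil>"
proof -
  have "a * k \<le> n + k - 1"
    using assms less_eq_div_iff_mult_less_eq by blast
  then have "a * k < n + k" using assms(1) by linarith
  then have "real a * real k < real n + real k" by (metis of_nat_add of_nat_less_iff of_nat_mult)
  then have "real a - 1 < real n / real k" using assms(1) by (simp add: field_simps)
  then show ?thesis by linarith
qed

section \<open>Arcs of the product graph as grid neighbours\<close>

lemma arc_cartesian_productD:
  "((u, x), (v, y)) \<in> parcs (G \<box> H) \<Longrightarrow> u = v \<and> (x, y) \<in> parcs H \<or> (u, v) \<in> parcs G \<and> x = y"
  by (auto simp: cartesian_product_def)

lemma arc_path_graphD: "(i, j) \<in> parcs (path_graph n) \<Longrightarrow> j = Suc i \<or> i = Suc j"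
  by (auto simp: path_graph_def)

lemma arc_path_graph_2D: "(i, j) \<in> parcs (path_graph 2) \<Longrightarrow> j = 1 - i \<and> i = 1 - j"
  by (auto simp: path_graph_def)

lemma arc_grid_nbrs:
  assumes "(u, v) \<in> parcs (path_graph 2 \<box> path_graph 2 \<box> path_graph 2 \<box> path_graph n)"
  shows "v \<in> grid_nbrs u \<and> u \<in> grid_nbrs v"
proof -
  obtain a b c l a' b' c' l' where uv: "u = (((a, b), c), l)" "v = (((a', b'), c'), l')"
    by (metis surj_pair)
  consider "(a, a') \<in> parcs (path_graph 2)" "b = b'" "c = c'" "l = l'"
    | "a = a'" "(b, b') \<in> parcs (path_graph 2)" "c = c'" "l = l'"
    | "a = a'" "b = b'" "(c, c') \<in> parcs (path_graph 2)" "l = l'"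
    | "a = a'" "b = b'" "c = c'" "(l, l') \<in> parcs (path_graph n)"
    using assms unfolding uv by (blast dest: arc_cartesian_productD)
  then show ?thesis
    by cases (auto simp: uv grid_nbrs_def dest!: arc_path_graph_2D arc_path_graphD[of l])
qed

theorem theorem10:
  fixes n\<^sub>4 k :: nat
  assumes "k \<ge> 2"
  shows "equitably_list_arborable TYPE('c) k
    (with_proj (path_graph 2 \<box> path_graph 2 \<box> path_graph 2 \<box> path_graph n\<^sub>4))"
  unfolding equitably_list_arborable_def
proof (intro allI impI)
  let ?G = "path_graph 2 \<box> path_graph 2 \<box> path_graph 2 \<box> path_graph n\<^sub>4"
  fix L :: "((nat \<times> nat) \<times> nat) \<times> nat \<Rightarrow> 'c set"
  assume L: "uniform_list_assignment (with_proj ?G) k L"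
  have V: "pverts ?G = cube \<times> {..<n\<^sub>4}"
    by (simp add: cartesian_product_def path_graph_def cube_def)
  have card_V: "card (pverts ?G) = 8 * n\<^sub>4"
    by (simp add: V cube_def card_cartesian_product)
  have card_L: "card (L v) = k" if "v \<in> cube \<times> {..<n\<^sub>4}" for v
    using L that unfolding uniform_list_assignment_def with_proj_simps V by blast
  have "\<exists>c. degenerate_colouring grid_nbrs L ((8 * n\<^sub>4 + k - 1) div k) (cube \<times> {..<n\<^sub>4}) c"
  proof (cases "k = 2")
    case True
    \<comment> \<open>For \<open>k = 2\<close> the bound evaluates to \<open>4 * n\<^sub>4\<close>,
      four vertices per layer.\<close>
    then show ?thesis using two_colours[of n\<^sub>4 L] card_L by simp
  next
    case False
    then have "3 \<le> k" using assms by simp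
    have "\<exists>c. degenerate_colouring grid_nbrs L ((card (cube \<times> {..<n\<^sub>4}) + k - 1) div k) (cube \<times> {..<n\<^sub>4}) c"
      using finite_cube \<open>3 \<le> k\<close> card_L by (intro at_least_three_colours) auto
    then show ?thesis unfolding card_V[unfolded V] .
  qed
  then obtain c where c: "\<And>v. v \<in> pverts ?G \<Longrightarrow> c v \<in> L v"
      "\<And>a. card {v \<in> pverts ?G. c v = a} \<le> (8 * n\<^sub>4 + k - 1) div k"
      "mono_degenerate grid_nbrs (pverts ?G) c"
    unfolding V degenerate_colouring_def by blast
  have "acyclic_graph (with_proj ?G \<restriction> colour_class (with_proj ?G) c x)" for x
    by (rule acyclic_colour_class[OF arc_grid_nbrs c(3)])
  moreover have "list_colouring (with_proj ?G) L c"
    using c(1) by (simp add: list_colouring_def)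
  moreover have "equitable_colouring (with_proj ?G) k c"
    unfolding equitable_colouring_def colour_class_def with_proj_simps
    using c(2) assms by (intro allI le_ceiling_divide) (simp_all add: card_V)
  ultimately show "\<exists>c. list_colouring (with_proj ?G) L c \<and> equitable_colouring (with_proj ?G) k c \<and>
      (\<forall>x. acyclic_graph (with_proj ?G \<restriction> colour_class (with_proj ?G) c x))"
    by blast
qed

end
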